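(* Let $(X,\omega_X)$ be a compact Kähler manifold of complex dimension $n$, let $\varphi$ be a continuous $\omega_X$-psh function with $(\omega_X+dd^c\varphi)^n=e^{\psi_+-\psi_-}\omega_X^n$, where $\psi_\pm$ are quasi-plurisubharmonic functions on $X$ with $e^{-\psi_-}\in L^1(\omega_X^n)$, and let $(\varphi_t)$ be the solution of the complex Monge–Ampère flow $(\omega_X+dd^c\varphi_t)^n=e^{\dot\varphi_t}\omega_X^n$ with initial datum $\varphi$. For all $(x,t)\in X\times\mathbb R^+$, $$\inf_X\varphi\le\varphi_t(x)\le\sup_X\varphi .$$
   Context: Notation: $d^c=\frac{1}{2i\pi}(\partial-\overline\partial)$, so $dd^c=\frac{i}{\pi}\partial\overline\partial$. A function is quasi-plurisubharmonic (qpsh) if it is locally the sum of a smooth and a plurisubharmonic function; it is $\omega_X$-psh if it is qpsh and $\omega_X+dd^c\varphi\ge0$ as currents. Monge–Ampère measures are in the sense of Bedford–Taylor. The flow: the solution is the unique function in $C^0(X\times[0,\infty))\cap C^\infty(X\times(0,\infty))$ with $\varphi_0=\varphi$, such that for $t>0$ the form $\omega_X+dd^c\varphi_t$ is Kähler and $(\omega_X+dd^c\varphi_t)^n=e^{\dot\varphi_t}\omega_X^n$. *)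

theory Defs
  imports "HOL-Analysis.Analysis" "HOL-Combinatorics.Permutations"
begin

section \<open>Smooth and holomorphic maps\<close>

text \<open>These notions are meant for open sets \<open>S\<close>.\<close>

primrec Ck_on :: "nat \<Rightarrow> 'a::real_normed_vector set \<Rightarrow> ('a \<Rightarrow> 'b::real_normed_vector) \<Rightarrow> bool" where
  "Ck_on 0 S f \<longleftrightarrow> continuous_on S f"
| "Ck_on (Suc k) S f \<longleftrightarrow>
     f differentiable_on S \<and> (\<forall>v. Ck_on k S (\<lambda>x. frechet_derivative f (at x) v))"

definition smooth_on :: "'a::real_normed_vector set \<Rightarrow> ('a \<Rightarrow> 'b::real_normed_vector) \<Rightarrow> bool" where
  "smooth_on S f \<longleftrightarrow> (\<forall>k. Ck_on k S f)"

definition holomorphic_map_on :: "(complex^'n) set \<Rightarrow> (complex^'n \<Rightarrow> complex^'m) \<Rightarrow> bool" where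
  "holomorphic_map_on S f \<longleftrightarrow>
     (\<forall>x\<in>S. \<exists>f'. (f has_derivative f') (at x) \<and> (\<forall>c v. f' (c *s v) = c *s f' v))"


section \<open>Differential forms on open subsets of complex n-space\<close>

text \<open>A complex-valued exterior form of degree \<open>k\<close> on the real vector space underlying
  \<open>complex^'n\<close> is represented by its values on lists of \<open>k\<close> vectors; it is set to 0 on lists
  of any other length, so that equal forms are equal functions.\<close>

type_synonym 'n form = "(complex^'n) list \<Rightarrow> complex"
type_synonym 'n form_field = "complex^'n \<Rightarrow> 'n form"

definition alt_form :: "nat \<Rightarrow> ('n::finite) form \<Rightarrow> bool" where
  "alt_form k \<theta> \<longleftrightarrow>
     (\<forall>vs. length vs \<noteq> k \<longrightarrow> \<theta> vs = 0) \<and>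
     (\<forall>vs i. length vs = k \<longrightarrow> i < k \<longrightarrow> linear (\<lambda>v. \<theta> (vs[i := v]))) \<and>
     (\<forall>vs i j. length vs = k \<longrightarrow> i < k \<longrightarrow> j < k \<longrightarrow> i \<noteq> j \<longrightarrow> vs ! i = vs ! j \<longrightarrow> \<theta> vs = 0)"

definition scalar_form :: "complex \<Rightarrow> 'n form" where
  "scalar_form c = (\<lambda>vs. if vs = [] then c else 0)"

text \<open>Exterior product of a form of degree \<open>p\<close> with a form of any degree, normalised so that
  \<open>(\<alpha> \<and> \<beta>)(v, w) = \<alpha> v * \<beta> w - \<alpha> w * \<beta> v\<close> for 1-forms.\<close>

definition wedge :: "nat \<Rightarrow> ('n::finite) form \<Rightarrow> 'n form \<Rightarrow> 'n form" where
  "wedge p \<alpha> \<beta> = (\<lambda>vs.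
     (\<Sum>\<sigma> | \<sigma> permutes {..<length vs}.
        of_int (sign \<sigma>) * \<alpha> (take p (permute_list \<sigma> vs)) * \<beta> (drop p (permute_list \<sigma> vs)))
     / (fact p * fact (length vs - p)))"

primrec wedge_power :: "('n::finite) form \<Rightarrow> nat \<Rightarrow> 'n form" where
  "wedge_power \<alpha> 0 = scalar_form 1"
| "wedge_power \<alpha> (Suc k) = wedge 2 \<alpha> (wedge_power \<alpha> k)"

text \<open>\<open>del_dir v\<close> and \<open>delbar_dir v\<close> are the complex linear and antilinear parts (in \<open>v\<close>) of the
  directional derivative, i.e. the contraction with \<open>v\<close> of the sum of \<open>dz_j (\<partial>/\<partial>z_j)\<close>,
  respectively of \<open>d(cnj z_j) (\<partial>/\<partial>(cnj z_j))\<close>.\<close>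

definition real_dir :: "complex^'n \<Rightarrow> (complex^'n \<Rightarrow> complex) \<Rightarrow> complex^('n::finite) \<Rightarrow> complex" where
  "real_dir v g x = frechet_derivative g (at x) v"

definition del_dir :: "complex^'n \<Rightarrow> (complex^'n \<Rightarrow> complex) \<Rightarrow> complex^('n::finite) \<Rightarrow> complex" where
  "del_dir v g x = (real_dir v g x - \<i> * real_dir (\<i> *s v) g x) / 2"

definition delbar_dir :: "complex^'n \<Rightarrow> (complex^'n \<Rightarrow> complex) \<Rightarrow> complex^('n::finite) \<Rightarrow> complex" where
  "delbar_dir v g x = (real_dir v g x + \<i> * real_dir (\<i> *s v) g x) / 2"

definition alternate_derivative ::
    "(complex^'n \<Rightarrow> (complex^'n \<Rightarrow> complex) \<Rightarrow> complex^'n \<Rightarrow> complex)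
       \<Rightarrow> ('n::finite) form_field \<Rightarrow> 'n form_field" where
  "alternate_derivative D \<theta> = (\<lambda>x vs.
     \<Sum>i<length vs. (-1) ^ i * D (vs ! i) (\<lambda>y. \<theta> y (take i vs @ drop (Suc i) vs)) x)"

definition ext_d :: "('n::finite) form_field \<Rightarrow> 'n form_field" where
  "ext_d = alternate_derivative real_dir"

definition del :: "('n::finite) form_field \<Rightarrow> 'n form_field" where
  "del = alternate_derivative del_dir"

definition delbar :: "('n::finite) form_field \<Rightarrow> 'n form_field" where
  "delbar = alternate_derivative delbar_dir"

definition dc :: "('n::finite) form_field \<Rightarrow> 'n form_field" where
  "dc \<theta> = (\<lambda>x vs. (del \<theta> x vs - delbar \<theta> x vs) / (2 * \<i> * pi))"

definition ddc :: "('n::finite) form_field \<Rightarrow> 'n form_field" where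
  "ddc \<theta> = ext_d (dc \<theta>)"

definition fun_form :: "(complex^'n \<Rightarrow> real) \<Rightarrow> 'n form_field" where
  "fun_form u = (\<lambda>x. scalar_form (complex_of_real (u x)))"

text \<open>A positively oriented orthonormal frame \<open>e_1, \<i> e_1, \<dots>, e_n, \<i> e_n\<close>. Since the vectors come
  in pairs, the value of a form of top degree on it does not depend on the enumeration of \<open>'n\<close>.\<close>

definition std_frame :: "(complex^('n::finite)) list" where
  "std_frame =
     concat (map (\<lambda>j. [axis j 1, axis j \<i>]) (SOME js. distinct js \<and> set js = (UNIV :: 'n set)))"

definition form_integral :: "('n::finite) form_field \<Rightarrow> complex" where
  "form_integral \<theta> = (\<integral>x. \<theta> x std_frame \<partial>lborel)"


section \<open>Test forms and currents\<close>

definition compact_supp_in :: "(complex^'n) set \<Rightarrow> ('n::finite) form_field \<Rightarrow> bool" where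
  "compact_supp_in V \<theta> \<longleftrightarrow>
     (\<exists>K. compact K \<and> K \<subseteq> V \<and> (\<forall>x vs. x \<notin> K \<longrightarrow> \<theta> x vs = 0))"

definition cont_test_forms :: "(complex^'n) set \<Rightarrow> nat \<Rightarrow> (('n::finite) form_field) set" where
  "cont_test_forms V k = {\<theta>. (\<forall>x. alt_form k (\<theta> x)) \<and> compact_supp_in V \<theta> \<and>
     (\<forall>vs. continuous_on UNIV (\<lambda>x. \<theta> x vs))}"

definition test_forms :: "(complex^'n) set \<Rightarrow> nat \<Rightarrow> (('n::finite) form_field) set" where
  "test_forms V k = {\<theta>. (\<forall>x. alt_form k (\<theta> x)) \<and> compact_supp_in V \<theta> \<and>
     (\<forall>vs. smooth_on UNIV (\<lambda>x. \<theta> x vs))}"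

text \<open>Currents of order zero on \<open>V\<close> (those with measure coefficients) are the linear functionals
  on continuous compactly supported forms of the complementary degree \<open>k\<close> that are continuous
  for uniform convergence with supports in a fixed compact set.\<close>

definition order_zero_current ::
    "(complex^'n) set \<Rightarrow> nat \<Rightarrow> (('n::finite) form_field \<Rightarrow> complex) \<Rightarrow> bool" where
  "order_zero_current V k T \<longleftrightarrow>
     (\<forall>\<theta>\<in>cont_test_forms V k. \<forall>\<eta>\<in>cont_test_forms V k. \<forall>c.
        T (\<lambda>x vs. \<theta> x vs + c * \<eta> x vs) = T \<theta> + c * T \<eta>) \<and>
     (\<forall>K. compact K \<longrightarrow> K \<subseteq> V \<longrightarrow> (\<exists>C. \<forall>\<theta>\<in>cont_test_forms V k. \<forall>B.
        (\<forall>x vs. x \<notin> K \<longrightarrow> \<theta> x vs = 0) \<longrightarrow>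
        (\<forall>x vs. (\<forall>v\<in>set vs. norm v \<le> 1) \<longrightarrow> cmod (\<theta> x vs) \<le> B) \<longrightarrow>
        cmod (T \<theta>) \<le> C * B))"

text \<open>\<open>elem_positive [a\<^sub>1, \<dots>, a\<^sub>p]\<close> is
  \<open>\<i> \<alpha>\<^sub>1 \<and> cnj \<alpha>\<^sub>1 \<and> \<dots> \<and> \<i> \<alpha>\<^sub>p \<and> cnj \<alpha>\<^sub>p\<close> for the (1,0)-forms \<open>\<alpha>\<^sub>i = \<Sum>j. a\<^sub>i $ j dz_j\<close>.
  Strongly positive forms are the elements of the convex cone generated by these.\<close>

definition covector :: "complex^'n \<Rightarrow> ('n::finite) form" where
  "covector a = (\<lambda>vs. if length vs = 1 then (\<Sum>j\<in>UNIV. a $ j * hd vs $ j) else 0)"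

primrec elem_positive :: "(complex^('n::finite)) list \<Rightarrow> 'n form" where
  "elem_positive [] = scalar_form 1"
| "elem_positive (a # as) =
     wedge 2 (\<lambda>vs. \<i> * wedge 1 (covector a) (\<lambda>ws. cnj (covector a ws)) vs) (elem_positive as)"

definition strongly_positive :: "nat \<Rightarrow> ('n::finite) form \<Rightarrow> bool" where
  "strongly_positive p \<theta> \<longleftrightarrow>
     (\<exists>S c. finite S \<and> (\<forall>as\<in>S. length as = p \<and> 0 \<le> (c as :: real)) \<and>
        \<theta> = (\<lambda>vs. \<Sum>as\<in>S. complex_of_real (c as) * elem_positive as vs))"

text \<open>Positivity on \<open>V\<close> of the (1,1)-current \<open>w + dd\<^sup>c u\<close>, for \<open>w\<close> a smooth 2-form and \<open>u\<close>
  a continuous function; it acts on test forms of bidegree (n-1, n-1).\<close>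

definition positive_current ::
    "(complex^'n) set \<Rightarrow> ('n::finite) form_field \<Rightarrow> (complex^'n \<Rightarrow> real) \<Rightarrow> bool" where
  "positive_current V w u \<longleftrightarrow>
     (\<forall>\<theta>\<in>test_forms V (2 * (CARD('n) - 1)). (\<forall>x. strongly_positive (CARD('n) - 1) (\<theta> x)) \<longrightarrow>
        (let I = form_integral (\<lambda>x vs. wedge 2 (w x) (\<theta> x) vs + complex_of_real (u x) * ddc \<theta> x vs)
         in Im I = 0 \<and> 0 \<le> Re I))"

text \<open>The Bedford--Taylor powers \<open>T\<^sub>k = (w + dd\<^sup>c u)^k\<close> on \<open>V\<close>, for \<open>w\<close> a smooth closed (1,1)-form and
  \<open>u\<close> continuous with \<open>w + dd\<^sup>c u \<ge> 0\<close>: \<open>T\<^sub>0 = 1\<close> and \<open>T\<^sub>k\<^sub>+\<^sub>1 = w \<and> T\<^sub>k + dd\<^sup>c (u T\<^sub>k)\<close>. If \<open>w = dd\<^sup>c \<rho>\<close>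
  locally, the latter is \<open>dd\<^sup>c ((\<rho> + u) T\<^sub>k)\<close>. The product \<open>u T\<^sub>k\<close> makes sense because \<open>T\<^sub>k\<close> has
  order zero. The predicate determines \<open>T\<close> on \<open>cont_test_forms V (2 * (n - k))\<close>, since smooth
  test forms are dense there.\<close>

primrec bedford_taylor ::
    "(complex^'n) set \<Rightarrow> ('n::finite) form_field \<Rightarrow> (complex^'n \<Rightarrow> real) \<Rightarrow> nat
       \<Rightarrow> ('n form_field \<Rightarrow> complex) \<Rightarrow> bool" where
  "bedford_taylor V w u 0 T \<longleftrightarrow> (\<forall>\<theta>\<in>cont_test_forms V (2 * CARD('n)). T \<theta> = form_integral \<theta>)"
| "bedford_taylor V w u (Suc k) T \<longleftrightarrow>
     order_zero_current V (2 * (CARD('n) - Suc k)) T \<and>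
     (\<exists>S. bedford_taylor V w u k S \<and>
        (\<forall>\<theta>\<in>test_forms V (2 * (CARD('n) - Suc k)).
           T \<theta> = S (\<lambda>x vs. wedge 2 (w x) (\<theta> x) vs + complex_of_real (u x) * ddc \<theta> x vs)))"


section \<open>Plurisubharmonic functions on open subsets of complex n-space\<close>

definition circle_mean :: "(complex^'n \<Rightarrow> ereal) \<Rightarrow> complex^('n::finite) \<Rightarrow> complex^'n \<Rightarrow> ereal" where
  "circle_mean u a v =
     (enn2ereal (\<integral>\<^sup>+t\<in>{0..2*pi}. e2ennreal (u (a + cis t *s v)) \<partial>lborel)
      - enn2ereal (\<integral>\<^sup>+t\<in>{0..2*pi}. e2ennreal (- u (a + cis t *s v)) \<partial>lborel)) / ereal (2 * pi)"

text \<open>\<open>e2ennreal\<close> truncates negative values to 0, so \<open>circle_mean\<close> is the difference of the integrals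
  of the positive and the negative part. For upper semicontinuous \<open>u < \<infinity>\<close> the first is finite.\<close>

definition psh_on :: "(complex^'n) set \<Rightarrow> (complex^('n::finite) \<Rightarrow> ereal) \<Rightarrow> bool" where
  "psh_on V u \<longleftrightarrow>
     (\<forall>z\<in>V. u z < \<infinity>) \<and>
     (\<forall>c. openin (top_of_set V) {z\<in>V. u z < c}) \<and>
     (\<forall>C\<in>components V. \<exists>z\<in>C. u z \<noteq> -\<infinity>) \<and>
     (\<forall>a v. (\<forall>\<zeta>. cmod \<zeta> \<le> 1 \<longrightarrow> a + \<zeta> *s v \<in> V) \<longrightarrow> u a \<le> circle_mean u a v)"


section \<open>Compact Kaehler manifolds\<close>

text \<open>A complex manifold of dimension \<open>CARD('n)\<close> is a Hausdorff space \<open>'x\<close> with a (not necessarily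
  maximal) holomorphic atlas. A chart is a pair of an open set and a map, whose values outside of the
  open set are irrelevant.\<close>

type_synonym ('x, 'n) chart = "'x set \<times> ('x \<Rightarrow> complex^'n)"

definition chart_image :: "('x, 'n) chart \<Rightarrow> (complex^'n) set" where
  "chart_image c = snd c ` fst c"

definition chart_inv :: "('x, 'n) chart \<Rightarrow> complex^'n \<Rightarrow> 'x" where
  "chart_inv c = inv_into (fst c) (snd c)"

definition transition :: "('x, 'n) chart \<Rightarrow> ('x, 'n) chart \<Rightarrow> complex^'n \<Rightarrow> complex^'n" where
  "transition c d = snd d \<circ> chart_inv c"

definition holomorphic_atlas :: "('x::t2_space, 'n::finite) chart set \<Rightarrow> bool" where
  "holomorphic_atlas A \<longleftrightarrow>
     (\<Union>c\<in>A. fst c) = UNIV \<and>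
     (\<forall>c\<in>A. open (fst c) \<and> open (chart_image c) \<and>
        homeomorphism (fst c) (chart_image c) (snd c) (chart_inv c)) \<and>
     (\<forall>c\<in>A. \<forall>d\<in>A. holomorphic_map_on (snd c ` (fst c \<inter> fst d)) (transition c d))"

text \<open>A form on the manifold is given by its expressions in the charts.\<close>

type_synonym ('x, 'n) manifold_form = "('x, 'n) chart \<Rightarrow> 'n form_field"

definition smooth_form ::
    "('x::t2_space, 'n::finite) chart set \<Rightarrow> nat \<Rightarrow> ('x, 'n) manifold_form \<Rightarrow> bool" where
  "smooth_form A k \<omega> \<longleftrightarrow>
     (\<forall>c\<in>A. (\<forall>z\<in>chart_image c. alt_form k (\<omega> c z)) \<and>
        (\<forall>vs. smooth_on (chart_image c) (\<lambda>z. \<omega> c z vs))) \<and>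
     (\<forall>c\<in>A. \<forall>d\<in>A. \<forall>x\<in>fst c \<inter> fst d. \<forall>vs.
        \<omega> c (snd c x) vs =
        \<omega> d (snd d x) (map (frechet_derivative (transition c d) (at (snd c x))) vs))"

definition kaehler_form ::
    "('x::t2_space, 'n::finite) chart set \<Rightarrow> ('x, 'n) manifold_form \<Rightarrow> bool" where
  "kaehler_form A \<omega> \<longleftrightarrow>
     smooth_form A 2 \<omega> \<and>
     (\<forall>c\<in>A. \<forall>z\<in>chart_image c.
        (\<forall>v w. \<omega> c z [v, w] \<in> \<real>) \<and>
        (\<forall>v w. \<omega> c z [\<i> *s v, \<i> *s w] = \<omega> c z [v, w]) \<and>
        (\<forall>v. v \<noteq> 0 \<longrightarrow> 0 < Re (\<omega> c z [v, \<i> *s v])) \<and>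
        (\<forall>vs. ext_d (\<omega> c) z vs = 0))"

definition compact_kaehler_manifold ::
    "('x::t2_space, 'n::finite) chart set \<Rightarrow> ('x, 'n) manifold_form \<Rightarrow> bool" where
  "compact_kaehler_manifold A \<omega> \<longleftrightarrow>
     compact (UNIV :: 'x set) \<and> holomorphic_atlas A \<and> kaehler_form A \<omega>"

text \<open>The measure defined by \<open>\<omega>^n\<close>, by gluing the measures obtained in the charts.\<close>

definition volume_measure ::
    "('x::t2_space, 'n::finite) chart set \<Rightarrow> ('x, 'n) manifold_form \<Rightarrow> 'x measure" where
  "volume_measure A \<omega> = (THE \<mu>. sets \<mu> = sets borel \<and>
     (\<forall>c\<in>A. \<forall>B\<in>sets borel. B \<subseteq> fst c \<longrightarrow>
        emeasure \<mu> B =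
        (\<integral>\<^sup>+z\<in>snd c ` B. ennreal (Re (wedge_power (\<omega> c z) CARD('n) std_frame)) \<partial>lborel)))"

text \<open>The form \<open>\<omega> + dd\<^sup>c u\<close>, for a function \<open>u\<close> on the manifold that is smooth.\<close>

definition plus_ddc ::
    "('x, 'n::finite) manifold_form \<Rightarrow> ('x \<Rightarrow> real) \<Rightarrow> ('x, 'n) manifold_form" where
  "plus_ddc \<omega> u = (\<lambda>c z vs. \<omega> c z vs + ddc (fun_form (u \<circ> chart_inv c)) z vs)"


section \<open>Quasi-plurisubharmonic functions and Monge--Ampere measures\<close>

definition qpsh :: "('x::t2_space, 'n::finite) chart set \<Rightarrow> ('x \<Rightarrow> ereal) \<Rightarrow> bool" where
  "qpsh A \<psi> \<longleftrightarrow>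
     (\<forall>x. \<exists>c\<in>A. x \<in> fst c \<and>
        (\<exists>V s p. open V \<and> snd c x \<in> V \<and> V \<subseteq> chart_image c \<and>
           smooth_on V (s :: complex^'n \<Rightarrow> real) \<and> psh_on V p \<and>
           (\<forall>z\<in>V. \<psi> (chart_inv c z) = ereal (s z) + p z)))"

definition continuous_omega_psh ::
    "('x::t2_space, 'n::finite) chart set \<Rightarrow> ('x, 'n) manifold_form \<Rightarrow> ('x \<Rightarrow> real) \<Rightarrow> bool" where
  "continuous_omega_psh A \<omega> \<phi> \<longleftrightarrow>
     continuous_on UNIV \<phi> \<and> qpsh A (\<lambda>x. ereal (\<phi> x)) \<and>
     (\<forall>c\<in>A. positive_current (chart_image c) (\<omega> c) (\<phi> \<circ> chart_inv c))"

definition monge_ampere_measure ::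
    "('x::t2_space, 'n::finite) chart set \<Rightarrow> ('x, 'n) manifold_form \<Rightarrow> ('x \<Rightarrow> real) \<Rightarrow> 'x measure \<Rightarrow> bool"
  where
  "monge_ampere_measure A \<omega> \<phi> \<mu> \<longleftrightarrow>
     sets \<mu> = sets borel \<and> finite_measure \<mu> \<and>
     (\<forall>c\<in>A. \<exists>T. bedford_taylor (chart_image c) (\<omega> c) (\<phi> \<circ> chart_inv c) CARD('n) T \<and>
        (\<forall>\<theta>\<in>test_forms (chart_image c) 0. T \<theta> = (LINT x:fst c|\<mu>. \<theta> (snd c x) [])))"

text \<open>The exponential on the extended reals.\<close>

definition eexp :: "ereal \<Rightarrow> ennreal" where
  "eexp a = (case a of ereal r \<Rightarrow> ennreal (exp r) | PInfty \<Rightarrow> \<infinity> | MInfty \<Rightarrow> 0)"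


section \<open>The complex Monge--Ampere flow\<close>

text \<open>\<open>\<Phi> t\<close> is the function at time \<open>t\<close>; its values at negative times are irrelevant.\<close>

definition ma_flow_solution ::
    "('x::t2_space, 'n::finite) chart set \<Rightarrow> ('x, 'n) manifold_form \<Rightarrow> ('x \<Rightarrow> real)
       \<Rightarrow> (real \<Rightarrow> 'x \<Rightarrow> real) \<Rightarrow> bool" where
  "ma_flow_solution A \<omega> \<phi> \<Phi> \<longleftrightarrow>
     continuous_on (UNIV \<times> {0..}) (\<lambda>(x, t). \<Phi> t x) \<and>
     (\<forall>c\<in>A. smooth_on (chart_image c \<times> {0<..}) (\<lambda>(z, t). \<Phi> t (chart_inv c z))) \<and>
     \<Phi> 0 = \<phi> \<and>
     (\<forall>t>0. kaehler_form A (plus_ddc \<omega> (\<Phi> t))) \<and>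
     (\<forall>t>0. \<forall>c\<in>A. \<forall>z\<in>chart_image c. \<forall>vs.
        wedge_power (plus_ddc \<omega> (\<Phi> t) c z) CARD('n) vs =
        complex_of_real (exp (deriv (\<lambda>s. \<Phi> s (chart_inv c z)) t))
          * wedge_power (\<omega> c z) CARD('n) vs)"

end

theory Submission
  imports Defs
begin

text \<open>
  This is the parabolic maximum principle. Suppose that at some time \<open>t > 0\<close> the function
  \<open>\<Phi> t\<close> has a maximum at \<open>x\<close>. In a chart its second derivatives in all directions are
  nonpositive there, so \<open>dd\<^sup>c \<Phi> t\<close> is nonpositive on complex lines and \<open>\<omega> + dd\<^sup>c \<Phi> t \<le> \<omega>\<close>
  as Hermitian forms. The top exterior power is monotone on positive Hermitian forms, so the flow
  equation gives \<open>exp (d/dt \<Phi>) \<le> 1\<close> and the time derivative of \<open>\<Phi>\<close> at \<open>(x, t)\<close> is at most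
  \<open>0\<close> (\<open>flow_velocity_nonpos_at_max\<close>). Now take a maximum of \<open>\<Phi> t x - \<epsilon> t\<close> over
  \<open>X \<times> [0, T]\<close>, which exists because \<open>X\<close> is compact and \<open>\<Phi>\<close> is continuous up to time 0. At a
  positive time the time derivative of \<open>\<Phi>\<close> would be at least \<open>\<epsilon>\<close>, so the maximum lies at time
  0, and letting \<open>\<epsilon>\<close> tend to 0 yields \<open>\<Phi> t x \<le> sup \<phi>\<close>
  (\<open>parabolic_maximum_principle\<close>). The lower bound is the same argument at minima.

  The monotonicity of the top power (\<open>wedge_power_monotone\<close>) is linear algebra. Two positive
  \<open>(1,1)\<close>-forms \<open>g \<le> h\<close> have a common orthogonal frame \<open>e\<^sub>1, \<i> e\<^sub>1, \<dots>, e\<^sub>n, \<i> e\<^sub>n\<close>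
  (\<open>simultaneous_orthogonal_frame\<close>), and \<open>h (e\<^sub>j, \<i> e\<^sub>j) = s\<^sub>j\<^sup>2 g (e\<^sub>j, \<i> e\<^sub>j)\<close> with \<open>s\<^sub>j \<ge> 1\<close>.
  Thus \<open>h\<close> arises from \<open>g\<close> by rescaling the frame, so \<open>h\<^sup>n\<close> on the frame is the product of all
  scaling factors times \<open>g\<^sup>n\<close> (\<open>wedge_power_rescale\<close>); it only remains to see that \<open>g\<^sup>n\<close> does
  not vanish there (\<open>wedge_power_symplectic_frame\<close>). No value of a top power is ever computed.
\<close>

section \<open>The sign of a list of integers\<close>

text \<open>For a list without repetitions this is the sign of the permutation that sorts it. The product of
  the signs of all differences is easier to use than a permutation: it changes sign under
  transpositions, and the factors belonging to an initial pair of neighbours cancel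
  (\<open>list_sign_partner\<close>).\<close>

primrec list_sign :: "int list \<Rightarrow> int" where
  "list_sign [] = 1"
| "list_sign (x # xs) = (\<Prod>y\<leftarrow>xs. sgn (y - x)) * list_sign xs"

lemma list_sign_append:
  "list_sign (xs @ ys) = list_sign xs * (\<Prod>x\<leftarrow>xs. \<Prod>y\<leftarrow>ys. sgn (y - x)) * list_sign ys"
  by (induction xs) (simp_all add: algebra_simps)

lemma prod_list_sgn_reverse:
  fixes a :: int
  shows "(\<Prod>y\<leftarrow>xs. sgn (a - y)) = (- 1) ^ length xs * (\<Prod>y\<leftarrow>xs. sgn (y - a))"
proof (induction xs)
  case (Cons x xs)
  have "sgn (a - x) = - sgn (x - a)" by (simp add: sgn_if)
  with Cons show ?case by simp
qed simp

text \<open>Exchanging the ends reverses all comparisons with the middle part, twice over, and the single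
  comparison between the ends.\<close>

lemma list_sign_swap_ends:
  "list_sign (a # ms @ [b]) = - list_sign (b # ms @ [a])"
proof -
  have 1: "sgn (b - a) = - sgn (a - b)" by (simp add: sgn_if)
  have F: "list_sign (c # ms @ [d]) = (\<Prod>y\<leftarrow>ms. sgn (y - c)) * sgn (d - c) *
         list_sign ms * ((- 1) ^ length ms * (\<Prod>y\<leftarrow>ms. sgn (y - d)))" for c d
    by (simp add: list_sign_append prod_list_sgn_reverse[of d])
  show ?thesis by (simp only: F[of a b] F[of b a] 1) (simp add: algebra_simps)
qed

lemma list_sign_swap:
  "list_sign (us @ (a # ms @ [b]) @ ws) = - list_sign (us @ (b # ms @ [a]) @ ws)"
proof -
  have "(\<Prod>x\<leftarrow>us. \<Prod>y\<leftarrow>(a # ms @ [b]). sgn (y - x)) = (\<Prod>x\<leftarrow>us. \<Prod>y\<leftarrow>(b # ms @ [a]). sgn (y - x))"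
    by (simp add: algebra_simps)
  moreover have "(\<Prod>x\<leftarrow>(a # ms @ [b]). \<Prod>y\<leftarrow>ws. sgn (y - x)) = (\<Prod>x\<leftarrow>(b # ms @ [a]). \<Prod>y\<leftarrow>ws. sgn (y - x))"
    by (simp add: algebra_simps)
  ultimately show ?thesis
    unfolding list_sign_append[of us] list_sign_append[of _ ws] list_sign_swap_ends[of a ms b]
    by (simp add: algebra_simps)
qed

lemma list_sign_transpose:
  assumes "i < j" "j < length xs"
  shows "list_sign (permute_list (Transposition.transpose i j) xs) = - list_sign xs"
proof -
  define us ms ws where "us = take i xs" and "ms = take (j - Suc i) (drop (Suc i) xs)"
    and "ws = drop (Suc j) xs"
  have xs: "xs = us @ (xs ! i # ms @ [xs ! j]) @ ws"
  proof -
    have "drop (Suc i) xs = ms @ drop (j - Suc i) (drop (Suc i) xs)"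
      unfolding ms_def by (rule append_take_drop_id[symmetric])
    also have "drop (j - Suc i) (drop (Suc i) xs) = xs ! j # ws"
      using assms by (simp add: ws_def Cons_nth_drop_Suc)
    finally have "drop (Suc i) xs = ms @ xs ! j # ws" .
    thus ?thesis using id_take_nth_drop[of i xs] assms by (simp add: us_def)
  qed
  have l: "length us = i" "length ms = j - Suc i" using assms by (auto simp: us_def ms_def)
  have "permute_list (Transposition.transpose i j) xs = us @ (xs ! j # ms @ [xs ! i]) @ ws" (is "_ = ?r")
  proof (rule nth_equalityI)
    have "length xs = length (us @ (xs ! i # ms @ [xs ! j]) @ ws)" by (rule arg_cong[OF xs])
    thus len: "length (permute_list (Transposition.transpose i j) xs) = length ?r" by simp
    fix k assume "k < length (permute_list (Transposition.transpose i j) xs)"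
    hence k: "k < length xs" by simp
    have lhs: "permute_list (Transposition.transpose i j) xs ! k = xs ! Transposition.transpose i j k"
      using k by (simp add: permute_list_def)
    consider "k = i" | "k = j" | "k \<noteq> i" "k \<noteq> j" by blast
    then show "permute_list (Transposition.transpose i j) xs ! k = ?r ! k"
    proof cases
      case 3
      have "xs ! k = (us @ (xs ! i # ms @ [xs ! j]) @ ws) ! k" by (rule arg_cong[OF xs])
      also have "\<dots> = ?r ! k" using 3 l assms
        by (auto simp: nth_append nth_Cons split: nat.splits)
      finally show ?thesis using lhs 3 by (simp add: Transposition.transpose_def)
    qed (use lhs l assms in \<open>auto simp: nth_append nth_Cons split: nat.splits\<close>)
  qed
  hence "list_sign (permute_list (Transposition.transpose i j) xs)
      = - list_sign (us @ (xs ! i # ms @ [xs ! j]) @ ws)"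
    by (simp only: list_sign_swap[of us "xs ! j" ms "xs ! i" ws])
  thus ?thesis by (simp only: xs[symmetric])
qed

text \<open>Both sides are multiplicative in the permutation, so transpositions suffice.\<close>

lemma list_sign_permute_list:
  assumes "\<sigma> permutes {..<length xs}"
  shows "list_sign (permute_list \<sigma> xs) = sign \<sigma> * list_sign xs"
proof -
  have "\<forall>xs. length xs = n \<longrightarrow> list_sign (permute_list \<sigma> xs) = sign \<sigma> * list_sign xs" 
    if "\<sigma> permutes {..<n}" for n and \<sigma> :: "nat \<Rightarrow> nat"
    using finite_lessThan that
  proof (induction \<sigma> rule: permutes_rev_induct)
    case id
    then show ?case by simp
  next
    case (swap a b p)
    show ?case
    proof (intro allI impI)
      fix xs :: "int list" assume len: "length xs = n"
      have ab: "a < length xs" "b < length xs" using swap(1,2) len by auto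
      have tp: "Transposition.transpose a b permutes {..<length xs}" using ab by (intro permutes_swap_id) auto
      have "permute_list (p \<circ> Transposition.transpose a b) xs = permute_list (Transposition.transpose a b) (permute_list p xs)"
        using tp by (rule permute_list_compose)
      moreover have "list_sign (permute_list (Transposition.transpose a b) ys) = - list_sign ys" if "length ys = n" for ys
      proof (cases "a < b")
        case True then show ?thesis using ab len that by (intro list_sign_transpose) auto
      next
        case False
        with swap(3) have "b < a" by auto
        then show ?thesis using ab len that list_sign_transpose[of b a ys] by (simp add: Transposition.transpose_commute)
      qed
      ultimately have "list_sign (permute_list (p \<circ> Transposition.transpose a b) xs) = - (sign p * list_sign xs)"
        using swap len by simp
      moreover have "sign (p \<circ> Transposition.transpose a b) = - sign p"
        using swap by (subst sign_compose)
          (auto simp: sign_swap_id permutation_swap_id permutes_imp_permutation[OF finite_lessThan])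
      ultimately show "list_sign (permute_list (p \<circ> Transposition.transpose a b) xs) = sign (p \<circ> Transposition.transpose a b) * list_sign xs"
        by simp
    qed
  qed
  with assms show ?thesis by blast
qed

section \<open>Powers of 2-forms on frames\<close>

lemma wedge_map:
  "wedge p \<alpha> \<beta> (map v xs) =
     (\<Sum>\<sigma> | \<sigma> permutes {..<length xs}. of_int (sign \<sigma>) * \<alpha> (map v (take p (permute_list \<sigma> xs)))
        * \<beta> (map v (drop p (permute_list \<sigma> xs)))) / (fact p * fact (length xs - p))"
proof -
  have "permute_list \<sigma> (map v xs) = map v (permute_list \<sigma> xs)" if "\<sigma> permutes {..<length xs}" for \<sigma>
    using that by (rule permute_list_map)
  then show ?thesis unfolding wedge_def by (auto simp: take_map drop_map intro!: sum.cong)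
qed

lemma permute_list_split2:
  assumes "\<sigma> permutes {..<length xs}" "2 \<le> length xs"
  obtains a b zs where "permute_list \<sigma> xs = a # b # zs" "mset xs = {#a, b#} + mset zs"
proof -
  from assms(2) have "2 \<le> length (permute_list \<sigma> xs)" by simp
  then obtain a b zs where *: "permute_list \<sigma> xs = a # b # zs"
    unfolding numeral_2_eq_2 Suc_le_length_iff by blast
  moreover have "mset xs = mset (permute_list \<sigma> xs)" using assms(1) by simp
  ultimately show ?thesis using that by simp
qed

lemma prod_list_mset_cong:
  assumes "mset xs = mset ys"
  shows "(\<Prod>x\<leftarrow>xs. f x) = (\<Prod>x\<leftarrow>ys. f x :: 'a::comm_monoid_mult)"
  by (metis assms mset_map prod_mset_prod_list)

text \<open>Every term in the expansion of the \<open>k\<close>-th power uses each entry of the list exactly once, so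
  it collects each factor exactly once. This compares two forms that are diagonal in the same frame
  without evaluating their powers.\<close>

lemma wedge_power_rescale:
  fixes v :: "'i \<Rightarrow> complex^('n::finite)" and s :: "'i \<Rightarrow> complex"
  assumes scale: "\<And>x y. x \<in> X \<Longrightarrow> y \<in> X \<Longrightarrow> \<beta> [v x, v y] = s x * s y * \<alpha> [v x, v y]"
    and "set xs \<subseteq> X" and "length xs = 2 * k"
  shows "wedge_power \<beta> k (map v xs) = (\<Prod>x\<leftarrow>xs. s x) * wedge_power \<alpha> k (map v xs)"
  using assms(2,3)
proof (induction k arbitrary: xs)
  case 0
  then show ?case by simp
next
  case (Suc k)
  have "of_int (sign \<sigma>) * \<beta> (map v (take 2 (permute_list \<sigma> xs)))
          * wedge_power \<beta> k (map v (drop 2 (permute_list \<sigma> xs)))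
      = (\<Prod>x\<leftarrow>xs. s x) * (of_int (sign \<sigma>) * \<alpha> (map v (take 2 (permute_list \<sigma> xs)))
          * wedge_power \<alpha> k (map v (drop 2 (permute_list \<sigma> xs))))"
    if \<sigma>: "\<sigma> permutes {..<length xs}" for \<sigma>
  proof -
    obtain a b zs where ys: "permute_list \<sigma> xs = a # b # zs" and m: "mset xs = {#a, b#} + mset zs"
      using permute_list_split2[OF \<sigma>] Suc.prems by auto
    have set: "set xs = insert a (insert b (set zs))" using arg_cong[OF m, of set_mset] by simp
    have "length zs = 2 * k" using arg_cong[OF m, of size] Suc.prems by simp
    with Suc.IH[of zs] Suc.prems set
    have "wedge_power \<beta> k (map v zs) = (\<Prod>x\<leftarrow>zs. s x) * wedge_power \<alpha> k (map v zs)" by auto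
    moreover have "\<beta> [v a, v b] = s a * s b * \<alpha> [v a, v b]" using scale set Suc.prems by auto
    moreover have "(\<Prod>x\<leftarrow>xs. s x) = s a * s b * (\<Prod>x\<leftarrow>zs. s x)"
      using prod_list_mset_cong[of xs "a # b # zs" s] m by (simp add: ac_simps)
    ultimately show ?thesis by (simp add: ys)
  qed
  hence "(\<Sum>\<sigma> | \<sigma> permutes {..<length xs}. of_int (sign \<sigma>) * \<beta> (map v (take 2 (permute_list \<sigma> xs)))
          * wedge_power \<beta> k (map v (drop 2 (permute_list \<sigma> xs))))
      = (\<Prod>x\<leftarrow>xs. s x) * (\<Sum>\<sigma> | \<sigma> permutes {..<length xs}. of_int (sign \<sigma>) *
          \<alpha> (map v (take 2 (permute_list \<sigma> xs)))
          * wedge_power \<alpha> k (map v (drop 2 (permute_list \<sigma> xs))))"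
    unfolding sum_distrib_left by (intro sum.cong) auto
  then show ?case by (simp add: wedge_map)
qed

text \<open>The integers \<open>2j\<close> and \<open>2j + 1\<close> stand for \<open>e\<^sub>j\<close> and \<open>\<i> e\<^sub>j\<close>; the partner of an index
  is the other member of its pair.\<close>

definition partner :: "int \<Rightarrow> int" where
  "partner x = (if even x then x + 1 else x - 1)"

lemma partner_iff: "y = partner x \<longleftrightarrow> x div 2 = y div 2 \<and> x \<noteq> y"
  unfolding partner_def by presburger

text \<open>No entry of \<open>zs\<close> lies between \<open>a\<close> and \<open>b\<close>, which are neighbouring integers. Hence it compares in the
  same way with both, and the two signs cancel.\<close>

lemma list_sign_partner:
  assumes "b = partner a" "a \<notin> set zs" "b \<notin> set zs"
  shows "list_sign (a # b # zs) = sgn (b - a) * list_sign zs"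
proof -
  have "(\<Prod>z\<leftarrow>zs. sgn (z - a)) * (\<Prod>z\<leftarrow>zs. sgn (z - b)) = 1"
    using assms(2,3)
  proof (induction zs)
    case (Cons z zs)
    have "sgn (z - a) * sgn (z - b) = 1" using Cons.prems assms(1) by (auto simp: sgn_if partner_def split: if_splits)
    with Cons show ?case by (simp add: algebra_simps)
  qed simp
  then show ?thesis by (simp add: algebra_simps)
qed

text \<open>A power of the form is nonzero on a frame in which the form is block diagonal: after
  multiplication by \<open>list_sign\<close>, no term in the expansion is negative. A permutation that does not
  start with a pair of partners contributes 0. For one that does, the sign of the permutation, the
  sign of the form on the pair and the sign of the power on the remaining list multiply to
  \<open>list_sign xs\<close>, by \<open>list_sign_permute_list\<close>, \<open>list_sign_partner\<close> and the induction hypothesis.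
  Some permutation moves a pair of partners to the front, so the sum is positive.\<close>

lemma wedge_power_symplectic_frame:
  fixes v :: "int \<Rightarrow> complex^('n::finite)"
  assumes orth: "\<And>x y. x \<in> X \<Longrightarrow> y \<in> X \<Longrightarrow> y \<noteq> partner x \<Longrightarrow> \<alpha> [v x, v y] = 0"
    and pair: "\<And>x y. x \<in> X \<Longrightarrow> y \<in> X \<Longrightarrow> y = partner x \<Longrightarrow>
                 \<exists>r>0. \<alpha> [v x, v y] = of_int (sgn (y - x)) * complex_of_real r"
    and "distinct xs" "set xs \<subseteq> X" "partner ` set xs \<subseteq> set xs" "length xs = 2 * k"
  shows "\<exists>r>0. of_int (list_sign xs) * wedge_power \<alpha> k (map v xs) = complex_of_real r"
  using assms(3-6)
proof (induction k arbitrary: xs)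
  case 0
  then show ?case by (auto simp: scalar_form_def intro!: exI[of _ 1])
next
  case (Suc k)
  define P where "P = {\<sigma>. \<sigma> permutes {..<length xs}}"
  define T where "T \<sigma> = of_int (sign \<sigma>) * \<alpha> (map v (take 2 (permute_list \<sigma> xs)))
          * wedge_power \<alpha> k (map v (drop 2 (permute_list \<sigma> xs)))" for \<sigma>
  have "\<exists>t. t \<ge> 0 \<and> of_int (list_sign xs) * T \<sigma> = complex_of_real t \<and>
           (permute_list \<sigma> xs ! 1 = partner (permute_list \<sigma> xs ! 0) \<longrightarrow> 0 < t)" if "\<sigma> \<in> P" for \<sigma>
  proof -
    have \<sigma>: "\<sigma> permutes {..<length xs}" using that by (simp add: P_def)
    obtain a b zs where ys: "permute_list \<sigma> xs = a # b # zs" and m: "mset xs = {#a, b#} + mset zs"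
      using permute_list_split2[OF \<sigma>] Suc.prems by auto
    have set: "set xs = insert a (insert b (set zs))" using arg_cong[OF m, of set_mset] by simp
    have len: "length zs = 2 * k" using arg_cong[OF m, of size] Suc.prems by simp
    have dist: "distinct (a # b # zs)"
      using Suc.prems(1) m by (metis mset_eq_imp_distinct_iff mset.simps(2) add_mset_add_single union_mset_add_mset_left add_0)
    have ab: "a \<in> X" "b \<in> X" using Suc.prems(2) set by auto
    have T: "T \<sigma> = of_int (sign \<sigma>) * \<alpha> [v a, v b] * wedge_power \<alpha> k (map v zs)"
      by (simp add: T_def ys)
    show ?thesis
    proof (cases "b = partner a")
      case False
      then show ?thesis using orth ab by (auto simp: T ys)
    next
      case True
      obtain q where q: "q > 0" "\<alpha> [v a, v b] = of_int (sgn (b - a)) * complex_of_real q"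
        using pair ab True by blast
      have "partner ` set zs \<subseteq> set zs"
      proof
        fix y assume "y \<in> partner ` set zs"
        then obtain z where z: "z \<in> set zs" "y = partner z" by auto
        hence "y \<in> set xs" using Suc.prems(3) set by blast
        moreover have "y \<noteq> a" "y \<noteq> b" using z dist True partner_iff[of b a] partner_iff[of y z] by (metis distinct.simps(2) list.set_intros(2) partner_iff)+
        ultimately show "y \<in> set zs" using set by blast
      qed
      with Suc.IH[of zs] dist Suc.prems(2) set len
      obtain r where r: "r > 0" "of_int (list_sign zs) * wedge_power \<alpha> k (map v zs) = complex_of_real r"
        by auto
      have "list_sign (a # b # zs) = sgn (b - a) * list_sign zs"
        using dist True by (intro list_sign_partner) auto
      hence sg: "sign \<sigma> * list_sign xs = sgn (b - a) * list_sign zs"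
        using list_sign_permute_list[OF \<sigma>] unfolding ys by (simp only:)
      have one: "complex_of_int (sgn (b - a)) * of_int (sgn (b - a)) = 1"
        using dist by (auto simp: sgn_if)
      have "of_int (list_sign xs) * T \<sigma> =
          of_int (sign \<sigma> * list_sign xs) * \<alpha> [v a, v b] * wedge_power \<alpha> k (map v zs)"
        by (simp add: T)
      also have "\<dots> = (complex_of_int (sgn (b - a)) * of_int (sgn (b - a))) * q *
          (of_int (list_sign zs) * wedge_power \<alpha> k (map v zs))"
        unfolding sg by (simp only: q of_int_mult mult_ac)
      also have "\<dots> = complex_of_real (q * r)" by (simp only: one r) simp
      finally show ?thesis using q r by (intro exI[of _ "q * r"]) auto
    qed
  qed
  then obtain t where t: "\<And>\<sigma>. \<sigma> \<in> P \<Longrightarrow> t \<sigma> \<ge> 0 \<and> of_int (list_sign xs) * T \<sigma> = complex_of_real (t \<sigma>) \<and>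
           (permute_list \<sigma> xs ! 1 = partner (permute_list \<sigma> xs ! 0) \<longrightarrow> 0 < t \<sigma>)"
    by metis
  have fin: "finite P" unfolding P_def by (intro finite_permutations) simp
  obtain \<tau> where \<tau>: "\<tau> \<in> P" "permute_list \<tau> xs ! 1 = partner (permute_list \<tau> xs ! 0)"
  proof -
    have ne: "xs \<noteq> []" using Suc.prems(4) by auto
    define a b where "a = hd xs" and "b = partner a"
    have a: "a \<in> set xs" using ne by (simp add: a_def)
    have b: "b \<in> set (remove1 a xs)" using a Suc.prems(3) partner_iff[of b a] by (auto simp: b_def)
    have "mset (b # remove1 b (remove1 a xs)) = mset (remove1 a xs)"
      using b by (metis insert_DiffM mset.simps(2) mset_remove1 set_mset_mset)
    hence "mset (a # b # remove1 b (remove1 a xs)) = mset xs" using a by simp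
    then obtain \<tau> where "\<tau> permutes {..<length xs}"
        "permute_list \<tau> xs = a # b # remove1 b (remove1 a xs)"
      using mset_eq_permutation by metis
    with that[of \<tau>] show ?thesis by (simp add: P_def b_def)
  qed
  have pos: "0 < sum t P" using t \<tau> fin by (intro sum_pos2[of _ \<tau>]) auto
  have "of_int (list_sign xs) * wedge_power \<alpha> (Suc k) (map v xs)
      = (\<Sum>\<sigma>\<in>P. of_int (list_sign xs) * T \<sigma>) / (fact 2 * fact (length xs - 2))"
    by (simp add: wedge_map P_def T_def sum_distrib_left)
  also have "(\<Sum>\<sigma>\<in>P. of_int (list_sign xs) * T \<sigma>) = complex_of_real (sum t P)" using t by simp
  finally have "of_int (list_sign xs) * wedge_power \<alpha> (Suc k) (map v xs)
      = complex_of_real (sum t P / (fact 2 * fact (length xs - 2)))" by simp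
  with pos show ?case by (intro exI[of _ "sum t P / (fact 2 * fact (length xs - 2))"]) simp
qed

section \<open>Simultaneous diagonalization of Hermitian forms\<close>

text \<open>The imaginary part, up to sign, of a Hermitian form; the corresponding symmetric form is
  \<open>G v (\<i> *s w)\<close>.\<close>

definition invariant_2form :: "(complex^'n \<Rightarrow> complex^'n \<Rightarrow> real) \<Rightarrow> bool" where
  "invariant_2form G \<longleftrightarrow> bilinear G \<and> (\<forall>v. G v v = 0) \<and> (\<forall>v w. G (\<i> *s v) (\<i> *s w) = G v w)"

definition positive_2form :: "(complex^'n \<Rightarrow> complex^'n \<Rightarrow> real) \<Rightarrow> bool" where
  "positive_2form G \<longleftrightarrow> invariant_2form G \<and> (\<forall>v. v \<noteq> 0 \<longrightarrow> 0 < G v (\<i> *s v))"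

lemma ii_scale: "\<i> *s (\<i> *s v) = - (v :: complex^'n)"
  by (simp add: vector_smult_assoc)

lemma linear_cscale: "linear ((*s) c :: complex^'n \<Rightarrow> complex^'n)"
  by (rule linearI) (simp_all add: vec_eq_iff algebra_simps scaleR_conv_of_real)

lemma invariant_2form_skew:
  assumes "invariant_2form G" shows "G v w = - G w v"
proof -
  have b: "bilinear G" and z: "\<And>v. G v v = 0" using assms by (auto simp: invariant_2form_def)
  have "0 = G (v + w) (v + w)" by (simp only: z)
  also have "\<dots> = G v w + G w v"
    unfolding bilinear_ladd[OF b] bilinear_radd[OF b] by (simp add: z)
  finally show ?thesis by simp
qed

lemma invariant_2form_shift:
  assumes "invariant_2form G" shows "G (\<i> *s v) w = - G v (\<i> *s w)"
proof -
  have b: "bilinear G" using assms by (auto simp: invariant_2form_def)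
  have "G (\<i> *s v) w = G (\<i> *s (\<i> *s v)) (\<i> *s w)"
    using assms unfolding invariant_2form_def by metis
  also have "\<dots> = - G v (\<i> *s w)" by (simp add: ii_scale bilinear_lneg[OF b])
  finally show ?thesis .
qed

lemma invariant_2form_symmetric:
  assumes "invariant_2form G" shows "G v (\<i> *s w) = G w (\<i> *s v)"
  using invariant_2form_skew[OF assms] invariant_2form_shift[OF assms] by (metis minus_minus)

lemma invariant_2form_diff:
  assumes "invariant_2form G" "invariant_2form H"
  shows "invariant_2form (\<lambda>v w. c * G v w - H v w)"
proof -
  have b: "bilinear G" "bilinear H" using assms by (auto simp: invariant_2form_def)
  have "bilinear (\<lambda>v w. c * G v w - H v w)"
    unfolding bilinear_def
    by (intro allI conjI linearI)
       (simp_all add: bilinear_ladd[OF b(1)] bilinear_ladd[OF b(2)] bilinear_radd[OF b(1)] bilinear_radd[OF b(2)]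
          bilinear_lmul[OF b(1)] bilinear_lmul[OF b(2)] bilinear_rmul[OF b(1)] bilinear_rmul[OF b(2)] algebra_simps)
  then show ?thesis using assms by (auto simp: invariant_2form_def)
qed

text \<open>The Cauchy--Schwarz inequality for the semidefinite symmetric form \<open>K v (\<i> *s w)\<close>, in the
  degenerate case. Otherwise the form would be negative somewhere on the line
  through \<open>e\<close> in direction \<open>\<i> *s w\<close>, where its quadratic function has its zero at \<open>e\<close> but a
  nonzero slope.\<close>

lemma semidefinite_null_vector:
  assumes K: "invariant_2form K" and W: "subspace W" "\<And>w. w \<in> W \<Longrightarrow> \<i> *s w \<in> W"
    and nonneg: "\<And>w. w \<in> W \<Longrightarrow> 0 \<le> K w (\<i> *s w)"
    and e: "e \<in> W" "K e (\<i> *s e) = 0" and w: "w \<in> W"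
  shows "K e w = 0"
proof -
  have b: "bilinear K" using K by (auto simp: invariant_2form_def)
  have *: "K e (\<i> *s u) = 0" if u: "u \<in> W" for u
  proof -
    define b0 c where "b0 = K e (\<i> *s u)" and "c = K u (\<i> *s u)"
    have c: "c \<ge> 0" using nonneg u by (simp add: c_def)
    \<comment> \<open>The minimum on the line is at \<open>- b0 / c\<close>; the summand 1 covers the case \<open>c = 0\<close>.\<close>
    define t where "t = - b0 / (c + 1)"
    have "e + t *\<^sub>R u \<in> W" using W e u by (auto intro: subspace_add subspace_scale)
    hence "0 \<le> K (e + t *\<^sub>R u) (\<i> *s (e + t *\<^sub>R u))" by (rule nonneg)
    also have "\<i> *s (e + t *\<^sub>R u) = \<i> *s e + t *\<^sub>R (\<i> *s u)"
      by (simp add: linear_add[OF linear_cscale] linear_scale[OF linear_cscale])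
    also have "K (e + t *\<^sub>R u) (\<i> *s e + t *\<^sub>R (\<i> *s u)) = 2 * t * b0 + t\<^sup>2 * c"
      using e invariant_2form_symmetric[OF K, of u e]
      by (simp add: bilinear_ladd[OF b] bilinear_radd[OF b] bilinear_lmul[OF b] bilinear_rmul[OF b]
            b0_def c_def power2_eq_square algebra_simps)
    finally have "0 \<le> (2 * t * b0 + t\<^sup>2 * c) * (c + 1)\<^sup>2" by simp
    moreover have "t * (c + 1) = - b0" using c by (simp add: t_def)
    hence "(2 * t * b0 + t\<^sup>2 * c) * (c + 1)\<^sup>2 = - (b0\<^sup>2 * (c + 2))" by algebra
    ultimately have "b0\<^sup>2 * (c + 2) \<le> 0" by simp
    hence "b0 = 0" using c by (simp add: mult_le_0_iff)
    thus ?thesis by (simp add: b0_def)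
  qed
  have "\<i> *s (- (\<i> *s w)) = w" by (simp add: vector_smult_rneg ii_scale)
  moreover have "- (\<i> *s w) \<in> W" using W w by (auto intro: subspace_neg)
  ultimately show ?thesis using *[of "- (\<i> *s w)"] by simp
qed

text \<open>A count of dimensions: each \<open>a\<close> imposes two real linear conditions, which are fewer than the
  real dimension altogether.\<close>

lemma common_orthogonal_vector:
  fixes G :: "complex^'n \<Rightarrow> complex^('n::finite) \<Rightarrow> real"
  assumes G: "invariant_2form G" and F: "finite F" "card F < CARD('n)"
  obtains w where "w \<noteq> 0" "\<And>a. a \<in> F \<Longrightarrow> G a w = 0 \<and> G a (\<i> *s w) = 0"
proof -
  have b: "bilinear G" using G by (auto simp: invariant_2form_def)
  have lin: "linear (G a)" for a using b by (simp add: bilinear_def)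
  define F' where "F' = F \<union> (*s) \<i> ` F"
  define S where "S = (\<lambda>a. adjoint (G a) 1) ` F'"
  have fin: "finite S" using F by (simp add: S_def F'_def)
  have "card S \<le> card F'" unfolding S_def by (rule card_image_le) (simp add: F'_def F)
  also have "card F' \<le> card F + card ((*s) \<i> ` F)" unfolding F'_def by (rule card_Un_le)
  also have "\<dots> \<le> card F + card F" using card_image_le[OF F(1)] by simp
  also have "\<dots> < DIM(complex^'n)" using F(2) by (simp add: mult.commute)
  finally have "dim S < DIM(complex^'n)" using dim_le_card'[OF fin] by simp
  then obtain w where w: "w \<noteq> 0" "\<And>y. y \<in> span S \<Longrightarrow> orthogonal w y"
    using orthogonal_to_subspace_exists by blast
  have *: "G a w = 0" if "a \<in> F'" for a
  proof -
    have "adjoint (G a) 1 \<in> span S" using that by (auto simp: S_def intro: span_base)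
    hence "w \<bullet> adjoint (G a) 1 = 0" using w by (simp add: orthogonal_def)
    thus ?thesis using adjoint_works[OF lin, of w a 1] by (simp add: inner_commute)
  qed
  show ?thesis
  proof (rule that[OF w(1)])
    fix a assume a: "a \<in> F"
    have "G (\<i> *s a) w = 0" "G a w = 0" using a by (auto intro!: * simp: F'_def)
    thus "G a w = 0 \<and> G a (\<i> *s w) = 0" using invariant_2form_shift[OF G, of a w] by simp
  qed
qed

text \<open>A maximizer \<open>e\<close> of the Rayleigh quotient of \<open>H\<close> with respect to \<open>G\<close>, with maximum \<open>c\<close>. Then
  \<open>c G - H\<close> is semidefinite on \<open>W\<close> and \<open>e\<close> is a null vector of it.\<close>

lemma max_relative_eigenvector:
  fixes G H :: "complex^'n \<Rightarrow> complex^('n::finite) \<Rightarrow> real"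
  assumes G: "positive_2form G" and H: "invariant_2form H"
    and W: "subspace W" "\<And>w. w \<in> W \<Longrightarrow> \<i> *s w \<in> W" "\<exists>w\<in>W. w \<noteq> 0"
  obtains e c where "e \<in> W" "e \<noteq> 0" "\<And>w. w \<in> W \<Longrightarrow> H e w = c * G e w"
proof -
  have iG: "invariant_2form G" and pos: "\<And>v. v \<noteq> 0 \<Longrightarrow> 0 < G v (\<i> *s v)"
    using G by (auto simp: positive_2form_def)
  have bG: "bilinear G" and bH: "bilinear H" using iG H by (auto simp: invariant_2form_def)
  define S where "S = W \<inter> sphere 0 1"
  define R where "R w = H w (\<i> *s w) / G w (\<i> *s w)" for w
  have comp: "compact S" unfolding S_def using W by (simp add: closed_subspace closed_Int_compact)
  have unit: "(1 / norm w) *\<^sub>R w \<in> S" if "w \<in> W" "w \<noteq> 0" for w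
    using that W by (simp add: S_def subspace_scale)
  hence ne: "S \<noteq> {}" using W by blast
  have cont: "continuous_on S (\<lambda>w. Q w (\<i> *s w))" if "bilinear Q" for Q :: "complex^'n \<Rightarrow> complex^'n \<Rightarrow> real"
    using that unfolding bilinear_conv_bounded_bilinear
    by (intro bounded_bilinear.continuous_on[of Q] continuous_on_id linear_continuous_on)
       (auto simp: linear_cscale simp flip: linear_conv_bounded_linear)
  have "G w (\<i> *s w) \<noteq> 0" if "w \<in> S" for w
  proof -
    have "w \<noteq> 0" using that by (auto simp: S_def)
    from pos[OF this] show ?thesis by simp
  qed
  hence "continuous_on S R"
    unfolding R_def by (intro continuous_on_divide cont bG bH) auto
  then obtain e where e: "e \<in> S" "\<And>w. w \<in> S \<Longrightarrow> R w \<le> R e"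
    using continuous_attains_sup[OF comp ne] by blast
  have e0: "e \<in> W" "e \<noteq> 0" using e by (auto simp: S_def)
  define K where "K = (\<lambda>v w. R e * G v w - H v w)"
  have K: "invariant_2form K" unfolding K_def by (rule invariant_2form_diff[OF iG H])
  have nonneg: "0 \<le> K w (\<i> *s w)" if w: "w \<in> W" for w
  proof (cases "w = 0")
    case True
    then show ?thesis by (simp add: K_def bilinear_lzero[OF bG] bilinear_lzero[OF bH])
  next
    case False
    have "R ((1 / norm w) *\<^sub>R w) = R w"
      using False by (simp add: R_def linear_scale[OF linear_cscale] bilinear_lmul[OF bG] bilinear_rmul[OF bG]
          bilinear_lmul[OF bH] bilinear_rmul[OF bH])
    hence "R w \<le> R e" using e(2)[OF unit[OF w False]] by simp
    thus ?thesis using pos[OF False] by (simp add: K_def R_def pos_divide_le_eq)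
  qed
  have "K e (\<i> *s e) = 0" using pos[OF e0(2)] by (simp add: K_def R_def)
  hence "K e w = 0" if "w \<in> W" for w
    using semidefinite_null_vector[OF K W(1,2) nonneg e0(1)] that by blast
  hence "H e w = R e * G e w" if "w \<in> W" for w using that by (simp add: K_def)
  with that e0 show ?thesis by blast
qed

text \<open>Each new vector is an eigenvector in the \<open>G\<close>-orthogonal complement of the earlier ones. The last
  conjunct is the invariant that drives the induction: being \<open>G\<close>-orthogonal to the frame built so far
  entails being \<open>H\<close>-orthogonal to it, so the next vector is automatically orthogonal for both forms.\<close>

lemma simultaneous_orthogonal_frame:
  fixes G H :: "complex^'n \<Rightarrow> complex^('n::finite) \<Rightarrow> real"
  assumes G: "positive_2form G" and H: "invariant_2form H" and "m \<le> CARD('n)"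
  shows "\<exists>e. (\<forall>j<m. e j \<noteq> 0) \<and>
     (\<forall>j<m. \<forall>k<m. j \<noteq> k \<longrightarrow> G (e j) (e k) = 0 \<and> G (e j) (\<i> *s e k) = 0 \<and>
                              H (e j) (e k) = 0 \<and> H (e j) (\<i> *s e k) = 0) \<and>
     (\<forall>w. (\<forall>k<m. G (e k) w = 0 \<and> G (e k) (\<i> *s w) = 0) \<longrightarrow> (\<forall>j<m. H (e j) w = 0))"
  using assms(3)
proof (induction m)
  case 0
  then show ?case by simp
next
  case (Suc m)
  have iG: "invariant_2form G" using G by (simp add: positive_2form_def)
  have bG: "bilinear G" and bH: "bilinear H" using iG H by (auto simp: invariant_2form_def)
  obtain e where e: "\<forall>j<m. e j \<noteq> 0"
     "\<forall>j<m. \<forall>k<m. j \<noteq> k \<longrightarrow> G (e j) (e k) = 0 \<and> G (e j) (\<i> *s e k) = 0 \<and>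
                              H (e j) (e k) = 0 \<and> H (e j) (\<i> *s e k) = 0"
     "\<forall>w. (\<forall>k<m. G (e k) w = 0 \<and> G (e k) (\<i> *s w) = 0) \<longrightarrow> (\<forall>j<m. H (e j) w = 0)"
    using Suc.IH[OF Suc_leD[OF Suc.prems]] by (elim exE conjE) (rule that)
  note orth = e(2)[rule_format]
  define W where "W = {w. \<forall>k<m. G (e k) w = 0 \<and> G (e k) (\<i> *s w) = 0}"
  have W1: "subspace W"
    by (auto simp: subspace_def W_def bilinear_radd[OF bG] bilinear_rmul[OF bG] bilinear_rzero[OF bG]
         linear_add[OF linear_cscale] linear_scale[OF linear_cscale] linear_0[OF linear_cscale])
  have W2: "\<i> *s w \<in> W" if "w \<in> W" for w
    using that by (auto simp: W_def ii_scale bilinear_rneg[OF bG])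
  have "card (e ` {..<m}) < CARD('n)"
    using card_image_le[of "{..<m}" e] Suc.prems by simp
  then obtain w where "w \<noteq> 0" "\<And>a. a \<in> e ` {..<m} \<Longrightarrow> G a w = 0 \<and> G a (\<i> *s w) = 0"
    using common_orthogonal_vector[OF iG, of "e ` {..<m}"] by blast
  hence W3: "\<exists>w\<in>W. w \<noteq> 0" by (auto simp: W_def)
  obtain x c where x: "x \<in> W" "x \<noteq> 0" and xc: "\<And>w. w \<in> W \<Longrightarrow> H x w = c * G x w"
    using max_relative_eigenvector[OF G H W1 W2 W3] by blast
  have He: "H (e j) w = 0" if "w \<in> W" "j < m" for w j
    using e(3) that unfolding W_def by blast
  have old: "G (e j) x = 0 \<and> G (e j) (\<i> *s x) = 0 \<and> H (e j) x = 0 \<and> H (e j) (\<i> *s x) = 0" if "j < m" for j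
    using that x(1) W2[OF x(1)] He by (auto simp: W_def)
  have new: "G x (e j) = 0 \<and> G x (\<i> *s e j) = 0 \<and> H x (e j) = 0 \<and> H x (\<i> *s e j) = 0" if "j < m" for j
    using old[OF that] invariant_2form_skew[OF iG, of x "e j"] invariant_2form_skew[OF H, of x "e j"]
      invariant_2form_symmetric[OF iG, of x "e j"] invariant_2form_symmetric[OF H, of x "e j"] by simp
  define e' where "e' = e(m := x)"
  have e'[simp]: "e' m = x" "\<And>j. j < m \<Longrightarrow> e' j = e j" by (auto simp: e'_def)
  show ?case
  proof (intro exI[of _ e'] conjI allI impI)
    show "e' j \<noteq> 0" if "j < Suc m" for j using that e(1) x by (auto simp: less_Suc_eq)
  next
    fix j k assume "j < Suc m" "k < Suc m" "j \<noteq> k"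
    then show "G (e' j) (e' k) = 0" "G (e' j) (\<i> *s e' k) = 0" "H (e' j) (e' k) = 0" "H (e' j) (\<i> *s e' k) = 0"
      using orth old new by (auto simp: less_Suc_eq)
  next
    fix w j assume w: "\<forall>k<Suc m. G (e' k) w = 0 \<and> G (e' k) (\<i> *s w) = 0" and j: "j < Suc m"
    have "w \<in> W" using w by (auto simp: W_def less_Suc_eq)
    moreover have "G x w = 0" using w e'(1) by (metis lessI)
    ultimately show "H (e' j) w = 0" using j He xc by (auto simp: less_Suc_eq)
  qed
qed

section \<open>Monotonicity of the top power\<close>

definition positive_11_form :: "('n::finite) form \<Rightarrow> bool" where
  "positive_11_form g \<longleftrightarrow> alt_form 2 g \<and> (\<forall>v w. g [v, w] \<in> \<real>) \<and>
     (\<forall>v w. g [\<i> *s v, \<i> *s w] = g [v, w]) \<and> (\<forall>v. v \<noteq> 0 \<longrightarrow> 0 < Re (g [v, \<i> *s v]))"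

lemma positive_11_form_Re:
  assumes "positive_11_form g"
  shows "positive_2form (\<lambda>v w. Re (g [v, w]))"
proof -
  have alt: "alt_form 2 g" using assms by (simp add: positive_11_form_def)
  have slot: "linear (\<lambda>u. g (vs[i := u]))" if "length vs = 2" "i < 2" for vs i
    using alt that unfolding alt_form_def by blast
  have "linear (\<lambda>u. g [u, w])" "linear (\<lambda>u. g [v, u])" for v w
    using slot[of "[v, w]" 0] slot[of "[v, w]" 1] by simp_all
  hence "linear (\<lambda>u. Re (g [u, w]))" "linear (\<lambda>u. Re (g [v, u]))" for v w
    using linear_compose[OF _ bounded_linear.linear[OF bounded_linear_Re]] unfolding o_def by blast+
  hence "bilinear (\<lambda>v w. Re (g [v, w]))" by (simp add: bilinear_def)
  moreover have "g [v, v] = 0" for v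
  proof -
    have "length [v, v] = 2 \<longrightarrow> 0 < (2::nat) \<longrightarrow> 1 < (2::nat) \<longrightarrow> 0 \<noteq> (1::nat) \<longrightarrow> [v, v] ! 0 = [v, v] ! 1 \<longrightarrow> g [v, v] = 0"
      using alt unfolding alt_form_def by blast
    thus ?thesis by simp
  qed
  ultimately show ?thesis
    using assms unfolding positive_2form_def invariant_2form_def positive_11_form_def by simp
qed

definition complex_frame :: "(nat \<Rightarrow> complex^'n) \<Rightarrow> int \<Rightarrow> complex^'n" where
  "complex_frame e x = (if even x then e (nat (x div 2)) else \<i> *s e (nat (x div 2)))"

lemma complex_frame_diagonal:
  assumes Q: "invariant_2form Q"
    and orth: "\<And>j k. j < n \<Longrightarrow> k < n \<Longrightarrow> j \<noteq> k \<Longrightarrow> Q (e j) (e k) = 0 \<and> Q (e j) (\<i> *s e k) = 0"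
    and x: "x \<in> {0..<2 * int n}" and y: "y \<in> {0..<2 * int n}"
  shows "Q (complex_frame e x) (complex_frame e y) =
    (if y = partner x then of_int (sgn (y - x)) * Q (e (nat (x div 2))) (\<i> *s e (nat (x div 2))) else 0)"
proof -
  have diag: "Q v v = 0" for v
    using Q by (auto simp: invariant_2form_def)
  have b: "bilinear Q" using Q by (auto simp: invariant_2form_def)
  note shift = invariant_2form_shift[OF Q]
  show ?thesis
  proof (cases "x div 2 = y div 2")
    case True
    have "x = y \<or> even x \<and> y = x + 1 \<or> odd x \<and> y = x - 1" using True by presburger
    then consider "x = y" | "even x" "y = x + 1" | "odd x" "y = x - 1" by blast
    then show ?thesis
    proof cases
      case 1 then show ?thesis by (simp add: diag partner_def)
    next
      case 2 then show ?thesis by (simp add: partner_def complex_frame_def)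
    next
      case 3 then show ?thesis using True by (simp add: partner_def complex_frame_def shift)
    qed
  next
    case False
    hence "nat (x div 2) \<noteq> nat (y div 2)" "nat (x div 2) < n" "nat (y div 2) < n" using x y by auto
    note * = orth[OF this(2,3,1)]
    moreover have "y \<noteq> partner x" using False partner_iff by blast
    ultimately show ?thesis by (simp add: complex_frame_def ii_scale shift bilinear_rneg[OF b])
  qed
qed

text \<open>In a common orthogonal frame the forms differ by a rescaling with factors at least 1, and the
  constant \<open>c\<close> is the product of these factors. The equality of the powers is assumed on all lists
  of vectors so that it can be evaluated on this frame.\<close>

lemma wedge_power_monotone:
  fixes g h :: "('n::finite) form"
  assumes g: "positive_11_form g" and h: "positive_11_form h"
    and le: "\<And>v. Re (g [v, \<i> *s v]) \<le> Re (h [v, \<i> *s v])"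
    and c: "\<And>vs. wedge_power h CARD('n) vs = complex_of_real c * wedge_power g CARD('n) vs"
  shows "1 \<le> c"
proof -
  define n where "n = CARD('n)"
  define G H where "G v w = Re (g [v, w])" and "H v w = Re (h [v, w])" for v w
  have G: "positive_2form G" and H: "positive_2form H"
    using positive_11_form_Re[OF g] positive_11_form_Re[OF h] unfolding G_def H_def by simp_all
  have iG: "invariant_2form G" and iH: "invariant_2form H"
    using G H by (auto simp: positive_2form_def)
  have gG: "g [v, w] = complex_of_real (G v w)" and hH: "h [v, w] = complex_of_real (H v w)" for v w
    using g h by (auto simp: positive_11_form_def G_def H_def)
  obtain e where e0: "\<And>j. j < n \<Longrightarrow> e j \<noteq> 0" and orth: "\<And>j k. j < n \<Longrightarrow> k < n \<Longrightarrow> j \<noteq> k \<Longrightarrow>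
       G (e j) (e k) = 0 \<and> G (e j) (\<i> *s e k) = 0 \<and> H (e j) (e k) = 0 \<and> H (e j) (\<i> *s e k) = 0"
    using simultaneous_orthogonal_frame[OF G iH order_refl] unfolding n_def by auto
  define a b where "a x = G (e (nat (x div 2))) (\<i> *s e (nat (x div 2)))"
    and "b x = H (e (nat (x div 2))) (\<i> *s e (nat (x div 2)))" for x :: int
  define X where "X = {0..<2 * int n}"
  have a: "0 < a x" and ab: "a x \<le> b x" if "x \<in> X" for x
  proof -
    have "nat (x div 2) < n" using that by (auto simp: X_def)
    from e0[OF this] G show "0 < a x" by (simp add: a_def positive_2form_def)
    show "a x \<le> b x" using le by (simp add: a_def b_def G_def H_def)
  qed
  have fG: "G (complex_frame e x) (complex_frame e y) = (if y = partner x then of_int (sgn (y - x)) * a x else 0)"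
    and fH: "H (complex_frame e x) (complex_frame e y) = (if y = partner x then of_int (sgn (y - x)) * b x else 0)"
    if "x \<in> X" "y \<in> X" for x y
    using complex_frame_diagonal[OF iG, of n e x y] complex_frame_diagonal[OF iH, of n e x y] orth that
    by (auto simp only: a_def b_def X_def)
  \<comment> \<open>Both vectors of a pair get the same factor, so that the form on the pair is multiplied by
    its square.\<close>
  define s where "s x = sqrt (b x / a x)" for x
  have s1: "1 \<le> s x" if "x \<in> X" for x using a[OF that] ab[OF that] by (simp add: s_def)
  have scale: "h [complex_frame e x, complex_frame e y] =
       complex_of_real (s x) * complex_of_real (s y) * g [complex_frame e x, complex_frame e y]"
    if "x \<in> X" "y \<in> X" for x y
  proof (cases "y = partner x")
    case True
    hence "s y = s x" using partner_iff[of y x] by (simp add: s_def a_def b_def)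
    moreover have "s x * s x * a x = b x" using a[OF that(1)] ab[OF that(1)] by (simp add: s_def)
    ultimately have "H (complex_frame e x) (complex_frame e y) = s x * s y * G (complex_frame e x) (complex_frame e y)"
      unfolding fG[OF that] fH[OF that] using True by (auto simp: algebra_simps)
    then show ?thesis by (simp add: gG hH)
  next
    case False
    then show ?thesis by (simp add: gG hH fG[OF that] fH[OF that])
  qed
  define xs where "xs = [0..2 * int n - 1]"
  have xs: "set xs = X" "distinct xs" "length xs = 2 * n" by (auto simp: xs_def X_def)
  have "wedge_power h n (map (complex_frame e) xs)
      = (\<Prod>x\<leftarrow>xs. complex_of_real (s x)) * wedge_power g n (map (complex_frame e) xs)"
    by (rule wedge_power_rescale[where X = X]) (simp_all add: xs scale)
  moreover have "\<exists>r>0. of_int (list_sign xs) * wedge_power g n (map (complex_frame e) xs) = complex_of_real r"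
  proof (rule wedge_power_symplectic_frame[where X = X])
    fix x y assume xy: "x \<in> X" "y \<in> X"
    show "g [complex_frame e x, complex_frame e y] = 0" if "y \<noteq> partner x"
      using that by (simp add: gG fG[OF xy])
    show "\<exists>r>0. g [complex_frame e x, complex_frame e y] = of_int (sgn (y - x)) * complex_of_real r"
      if "y = partner x" unfolding gG fG[OF xy] using that a[OF xy(1)]
      by (intro exI[of _ "a x"]) simp
  next
    have "partner x \<in> X" if "x \<in> X" for x
      using that by (auto simp: X_def partner_def elim!: evenE oddE)
    thus "partner ` set xs \<subseteq> set xs" by (auto simp: xs)
  qed (simp_all add: xs)
  hence "wedge_power g n (map (complex_frame e) xs) \<noteq> 0" by auto
  ultimately have "complex_of_real c = (\<Prod>x\<leftarrow>xs. complex_of_real (s x))"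
    using c by (simp add: n_def)
  also have "\<dots> = complex_of_real (\<Prod>x\<leftarrow>xs. s x)" by (induction xs) auto
  finally have "c = (\<Prod>x\<leftarrow>xs. s x)" by (simp only: of_real_eq_iff)
  moreover have "1 \<le> (\<Prod>x\<leftarrow>ys. s x)" if "set ys \<subseteq> X" for ys
    using that
  proof (induction ys)
    case (Cons y ys)
    then have "1 * 1 \<le> s y * (\<Prod>x\<leftarrow>ys. s x)" by (intro mult_mono s1) (use s1[of y] in auto)
    then show ?case by simp
  qed simp
  ultimately show ?thesis using xs by simp
qed

section \<open>Second derivatives and extrema\<close>

text \<open>The first derivative vanishes at a maximum. If the second were positive, the first derivative
  would be positive just to the right, and \<open>q\<close> would increase.\<close>

lemma second_derivative_nonpos_at_max:
  fixes q q' :: "real \<Rightarrow> real"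
  assumes d: "0 < d"
    and q: "\<And>s. \<bar>s\<bar> < d \<Longrightarrow> (q has_real_derivative q' s) (at s)"
    and q': "(q' has_real_derivative D) (at 0)"
    and max: "\<And>s. \<bar>s\<bar> < d \<Longrightarrow> q s \<le> q 0"
  shows "D \<le> 0"
proof (rule ccontr)
  assume "\<not> D \<le> 0"
  have q0: "q' 0 = 0"
    by (rule DERIV_local_max[OF q d]) (use d max in auto)
  obtain \<delta> where \<delta>: "\<delta> > 0" "\<And>h. 0 < h \<Longrightarrow> h < \<delta> \<Longrightarrow> 0 < q' h"
    using DERIV_pos_inc_right[OF q'] \<open>\<not> D \<le> 0\<close> q0 by auto
  define b where "b = min d \<delta> / 2"
  have b: "0 < b" "b < d" "b < \<delta>" using d \<delta> by (auto simp: b_def)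
  obtain \<xi> where \<xi>: "0 < \<xi>" "\<xi> < b" "q b - q 0 = (b - 0) * q' \<xi>"
    using MVT2[of 0 b q q'] b q by force
  have "0 < b * q' \<xi>" using \<xi> \<delta>(2)[of \<xi>] b by simp
  moreover have "q b \<le> q 0" using b by (intro max) auto
  ultimately show False using \<xi> by simp
qed

text \<open>The derivatives in \<open>Ck_on\<close> are taken in the whole space, so values outside of the open set do
  not matter.\<close>

lemma Ck_on_cong:
  assumes "Ck_on k S f" "open S" "\<And>x. x \<in> S \<Longrightarrow> f x = g x"
  shows "Ck_on k S g"
  using assms(1,3)
proof (induction k arbitrary: f g)
  case 0
  have "continuous_on S g"
    by (rule continuous_on_eq[OF _ 0(2)]) (use 0(1) in simp_all)
  then show ?case by simp
next
  case (Suc k)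
  have der: "(g has_derivative frechet_derivative f (at x)) (at x)" if "x \<in> S" for x
  proof -
    have "(f has_derivative frechet_derivative f (at x)) (at x)"
      using Suc.prems(1) that assms(2) by (simp add: differentiable_on_eq_differentiable_at frechet_derivative_works)
    from has_derivative_transform_within_open[OF this assms(2) that Suc.prems(2)] show ?thesis .
  qed
  have eq: "frechet_derivative f (at x) = frechet_derivative g (at x)" if "x \<in> S" for x
    using frechet_derivative_at[OF der[OF that]] .
  have "g differentiable_on S"
    using der unfolding differentiable_on_eq_differentiable_at[OF assms(2)] differentiable_def by blast
  moreover have "Ck_on k S (\<lambda>x. frechet_derivative g (at x) v)" for v
  proof (rule Suc.IH)
    show "Ck_on k S (\<lambda>x. frechet_derivative f (at x) v)" using Suc.prems(1) by simp
    show "frechet_derivative f (at x) v = frechet_derivative g (at x) v" if "x \<in> S" for x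
      by (simp only: eq[OF that])
  qed
  ultimately show ?case by simp
qed

lemma Ck_on_slice:
  assumes "Ck_on k (S \<times> T) F" "open S" "open T" "t \<in> T"
  shows "Ck_on k S (\<lambda>z. F (z, t))"
  using assms(1)
proof (induction k arbitrary: F)
  case 0
  then show ?case using assms(4)
    by (auto intro!: continuous_on_compose2[OF 0[simplified]] continuous_intros)
next
  case (Suc k)
  have op: "open (S \<times> T)" using assms by (simp add: open_Times)
  have der: "((\<lambda>z. F (z, t)) has_derivative (\<lambda>v. frechet_derivative F (at (z, t)) (v, 0))) (at z)"
    if "z \<in> S" for z
  proof -
    have F: "(F has_derivative frechet_derivative F (at (z, t))) (at (z, t))"
      using Suc.prems(1) that op assms(4) by (simp add: differentiable_on_eq_differentiable_at frechet_derivative_works)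
    have "((\<lambda>z. (z, t)) has_derivative (\<lambda>v. (v, 0))) (at z)"
      by (auto intro!: derivative_eq_intros)
    from has_derivative_compose[OF this F] show ?thesis .
  qed
  have eq: "frechet_derivative (\<lambda>z. F (z, t)) (at z) = (\<lambda>v. frechet_derivative F (at (z, t)) (v, 0))"
    if "z \<in> S" for z
    using frechet_derivative_at[OF der[OF that]] by simp
  have "(\<lambda>z. F (z, t)) differentiable_on S"
    using der unfolding differentiable_on_eq_differentiable_at[OF assms(2)] differentiable_def by blast
  moreover have "Ck_on k S (\<lambda>z. frechet_derivative (\<lambda>z. F (z, t)) (at z) v)" for v
    by (rule Ck_on_cong[OF Suc.IH[of "\<lambda>p. frechet_derivative F (at p) (v, 0)"]])
       (use Suc.prems assms(2) eq in auto)
  ultimately show ?case by simp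
qed

lemma Ck_on_2_derivatives:
  assumes "Ck_on 2 S u" "open S" "x \<in> S"
  shows "(u has_derivative frechet_derivative u (at x)) (at x)"
    and "((\<lambda>y. frechet_derivative u (at y) v) has_derivative
           frechet_derivative (\<lambda>y. frechet_derivative u (at y) v) (at x)) (at x)"
  using assms by (simp_all add: numeral_2_eq_2 differentiable_on_eq_differentiable_at frechet_derivative_works)

definition second_derivative :: "('a::real_normed_vector \<Rightarrow> 'b::real_normed_vector) \<Rightarrow> 'a \<Rightarrow> 'a \<Rightarrow> 'b" where
  "second_derivative u z v = frechet_derivative (\<lambda>y. frechet_derivative u (at y) v) (at z) v"

lemma has_real_derivative_along_line:
  fixes u :: "'a::real_normed_vector \<Rightarrow> real"
  assumes "(u has_derivative F) (at (z + s *\<^sub>R v))"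
  shows "((\<lambda>s. u (z + s *\<^sub>R v)) has_real_derivative F v) (at s)"
proof -
  have "((\<lambda>s. z + s *\<^sub>R v) has_derivative (\<lambda>h. h *\<^sub>R v)) (at s)"
    by (auto intro!: derivative_eq_intros)
  from has_derivative_compose[OF this assms]
  have "((\<lambda>s. u (z + s *\<^sub>R v)) has_derivative (\<lambda>h. F (h *\<^sub>R v))) (at s)" .
  moreover have "(\<lambda>h. F (h *\<^sub>R v)) = (*) (F v)"
    using linear_scale[OF has_derivative_linear[OF assms]] by (auto simp: mult.commute)
  ultimately show ?thesis by (simp add: has_field_derivative_def)
qed

lemma second_derivative_along_line:
  fixes u :: "'a::real_normed_vector \<Rightarrow> real"
  assumes u: "Ck_on 2 S u" "open S" "z \<in> S"
  obtains d where "0 < d" "\<And>s. \<bar>s\<bar> < d \<Longrightarrow> z + s *\<^sub>R v \<in> S"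
    "\<And>s. \<bar>s\<bar> < d \<Longrightarrow> ((\<lambda>s. u (z + s *\<^sub>R v)) has_real_derivative
                           frechet_derivative u (at (z + s *\<^sub>R v)) v) (at s)"
    "((\<lambda>s. frechet_derivative u (at (z + s *\<^sub>R v)) v) has_real_derivative
        second_derivative u z v) (at 0)"
proof -
  have "open ((\<lambda>s. z + s *\<^sub>R v) -` S)"
    by (intro open_vimage u(2) continuous_intros)
  moreover have "0 \<in> (\<lambda>s. z + s *\<^sub>R v) -` S" using u(3) by simp
  ultimately obtain d where d: "d > 0" "ball 0 d \<subseteq> (\<lambda>s. z + s *\<^sub>R v) -` S"
    using open_contains_ball by blast
  hence inS: "z + s *\<^sub>R v \<in> S" if "\<bar>s\<bar> < d" for s using that by (auto simp: subset_eq)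
  have "((\<lambda>s. frechet_derivative u (at (z + s *\<^sub>R v)) v) has_real_derivative
        second_derivative u z v) (at 0)"
    unfolding second_derivative_def
    using has_real_derivative_along_line[of "\<lambda>y. frechet_derivative u (at y) v" _ z 0 v]
      Ck_on_2_derivatives(2)[OF u, of v] by simp
  with that[OF d(1) inS has_real_derivative_along_line[OF Ck_on_2_derivatives(1)[OF u(1,2) inS]]]
  show ?thesis by blast
qed

lemma second_derivative_nonpos_at_local_max:
  fixes u :: "'a::real_normed_vector \<Rightarrow> real"
  assumes u: "Ck_on 2 S u" "open S" "z \<in> S" and max: "\<And>y. y \<in> S \<Longrightarrow> u y \<le> u z"
  shows "second_derivative u z v \<le> 0"
proof -
  obtain d where d: "0 < d" "\<And>s. \<bar>s\<bar> < d \<Longrightarrow> z + s *\<^sub>R v \<in> S"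
    and D: "\<And>s. \<bar>s\<bar> < d \<Longrightarrow> ((\<lambda>s. u (z + s *\<^sub>R v)) has_real_derivative
                           frechet_derivative u (at (z + s *\<^sub>R v)) v) (at s)"
      "((\<lambda>s. frechet_derivative u (at (z + s *\<^sub>R v)) v) has_real_derivative
          second_derivative u z v) (at 0)"
    by (rule second_derivative_along_line[OF u, where v = v]) (rule that)
  show ?thesis
    by (rule second_derivative_nonpos_at_max[OF d(1) D]) (simp_all add: max d(2))
qed

lemma second_derivative_nonneg_at_local_min:
  fixes u :: "'a::real_normed_vector \<Rightarrow> real"
  assumes u: "Ck_on 2 S u" "open S" "z \<in> S" and min: "\<And>y. y \<in> S \<Longrightarrow> u z \<le> u y"
  shows "0 \<le> second_derivative u z v"
proof -
  obtain d where d: "0 < d" "\<And>s. \<bar>s\<bar> < d \<Longrightarrow> z + s *\<^sub>R v \<in> S"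
    and D: "\<And>s. \<bar>s\<bar> < d \<Longrightarrow> ((\<lambda>s. u (z + s *\<^sub>R v)) has_real_derivative
                           frechet_derivative u (at (z + s *\<^sub>R v)) v) (at s)"
      "((\<lambda>s. frechet_derivative u (at (z + s *\<^sub>R v)) v) has_real_derivative
          second_derivative u z v) (at 0)"
    by (rule second_derivative_along_line[OF u, where v = v]) (rule that)
  have "- second_derivative u z v \<le> 0"
    by (rule second_derivative_nonpos_at_max[OF d(1) DERIV_minus[OF D(1)] DERIV_minus[OF D(2)]])
       (simp_all add: min d(2))
  then show ?thesis by simp
qed

lemma dc_fun_form:
  assumes u: "(u has_derivative frechet_derivative u (at y)) (at y)"
  shows "dc (fun_form u) y [w] = complex_of_real (- frechet_derivative u (at y) (\<i> *s w) / (2 * pi))"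
proof -
  have "real_dir w (\<lambda>y. complex_of_real (u y)) y = complex_of_real (frechet_derivative u (at y) w)" for w
  proof -
    have "((\<lambda>y. complex_of_real (u y)) has_derivative (\<lambda>h. complex_of_real (frechet_derivative u (at y) h))) (at y)"
      by (rule has_derivative_of_real[OF u])
    from frechet_derivative_at[OF this, symmetric] show ?thesis by (simp add: real_dir_def)
  qed
  thus ?thesis
    by (simp add: dc_def del_def delbar_def alternate_derivative_def del_dir_def delbar_dir_def
        fun_form_def scalar_form_def field_simps)
qed

text \<open>On a complex line \<open>dd\<^sup>c\<close> is the Laplacian, up to the factor \<open>1 / (2 * pi)\<close>. This ties the sign
  of \<open>dd\<^sup>c u\<close> to extrema of \<open>u\<close>.\<close>

lemma ddc_fun_form:
  assumes u: "Ck_on 2 S u" "open S" "z \<in> S"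
  shows "ddc (fun_form u) z [v, \<i> *s v]
    = complex_of_real ((second_derivative u z v + second_derivative u z (\<i> *s v)) / (2 * pi))"
proof -
  define D where "D w y = frechet_derivative u (at y) w" for w y
  have D: "(D w has_derivative frechet_derivative (D w) (at z)) (at z)" for w
    using Ck_on_2_derivatives(2)[OF u, of w] by (simp add: D_def[abs_def])
  note u1 = Ck_on_2_derivatives(1)[OF u(1,2)]
  have "dc (fun_form u) y [\<i> *s v] = complex_of_real (D v y / (2 * pi))" if "y \<in> S" for y
    using dc_fun_form[OF u1[OF that], of "\<i> *s v"] linear_neg[OF has_derivative_linear[OF u1[OF that]]]
    by (simp add: ii_scale D_def)
  moreover have "((\<lambda>y. complex_of_real (D v y / (2 * pi))) has_derivative
         (\<lambda>h. complex_of_real (frechet_derivative (D v) (at z) h / (2 * pi)))) (at z)"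
    by (intro has_derivative_of_real bounded_linear.has_derivative[OF bounded_linear_divide] D) 
  ultimately have "((\<lambda>y. dc (fun_form u) y [\<i> *s v]) has_derivative
         (\<lambda>h. complex_of_real (frechet_derivative (D v) (at z) h / (2 * pi)))) (at z)"
    by - (rule has_derivative_transform_within_open[OF _ u(2,3)], assumption, simp)
  from frechet_derivative_at[OF this, symmetric]
  have 1: "real_dir v (\<lambda>y. dc (fun_form u) y [\<i> *s v]) z = complex_of_real (second_derivative u z v / (2 * pi))"
    by (simp add: real_dir_def second_derivative_def D_def[abs_def])
  have "dc (fun_form u) y [v] = complex_of_real (- D (\<i> *s v) y / (2 * pi))" if "y \<in> S" for y
    using dc_fun_form[OF u1[OF that], of v] by (simp add: D_def)
  moreover have "((\<lambda>y. complex_of_real (- D (\<i> *s v) y / (2 * pi))) has_derivative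
         (\<lambda>h. complex_of_real (- frechet_derivative (D (\<i> *s v)) (at z) h / (2 * pi)))) (at z)"
    by (intro has_derivative_of_real bounded_linear.has_derivative[OF bounded_linear_divide] has_derivative_minus D)
  ultimately have "((\<lambda>y. dc (fun_form u) y [v]) has_derivative
         (\<lambda>h. complex_of_real (- frechet_derivative (D (\<i> *s v)) (at z) h / (2 * pi)))) (at z)"
    by - (rule has_derivative_transform_within_open[OF _ u(2,3)], assumption, simp)
  from frechet_derivative_at[OF this, symmetric]
  have 2: "real_dir (\<i> *s v) (\<lambda>y. dc (fun_form u) y [v]) z
      = complex_of_real (- second_derivative u z (\<i> *s v) / (2 * pi))"
    by (simp add: real_dir_def second_derivative_def D_def[abs_def])
  have "ddc (fun_form u) z [v, \<i> *s v] = real_dir v (\<lambda>y. dc (fun_form u) y [\<i> *s v]) z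
      - real_dir (\<i> *s v) (\<lambda>y. dc (fun_form u) y [v]) z"
    by (simp add: ddc_def ext_d_def alternate_derivative_def numeral_2_eq_2 lessThan_Suc)
  thus ?thesis unfolding 1 2 by (simp add: add_divide_distrib)
qed

section \<open>The parabolic maximum principle\<close>

text \<open>The perturbation by \<open>e * t\<close> makes the inequality strict: at a maximum over \<open>[0, T]\<close> at a
  positive time, possibly \<open>T\<close> itself, the time derivative of \<open>f t x - e * t\<close> is negative, so a
  slightly earlier time gives a larger value.\<close>

lemma parabolic_maximum_principle:
  fixes f :: "real \<Rightarrow> 'x::topological_space \<Rightarrow> real"
  assumes comp: "compact (UNIV :: 'x set)"
    and cont: "continuous_on (UNIV \<times> {0..}) (\<lambda>(x, t). f t x)"
    and crit: "\<And>t x. 0 < t \<Longrightarrow> (\<And>y. f t y \<le> f t x) \<Longrightarrow>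
                 \<exists>D\<le>0. ((\<lambda>s. f s x) has_real_derivative D) (at t)"
    and init: "\<And>x. f 0 x \<le> M" and T: "0 \<le> T"
  shows "f T x \<le> M"
proof -
  have bound: "f T x - e * T \<le> M" if e: "e > 0" for e
  proof -
    define Q where "Q = (UNIV :: 'x set) \<times> {0..T}"
    have "compact Q" unfolding Q_def by (intro compact_Times comp compact_Icc)
    moreover have "Q \<noteq> {}" using T by (auto simp: Q_def)
    moreover have "continuous_on Q (\<lambda>(x, t). f t x - e * t)"
      unfolding case_prod_beta Q_def
      by (intro continuous_intros continuous_on_subset[OF cont[unfolded case_prod_beta]]) auto
    ultimately obtain p where "p \<in> Q" "\<forall>r\<in>Q. (\<lambda>(x, t). f t x - e * t) r \<le> (\<lambda>(x, t). f t x - e * t) p"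
      using continuous_attains_sup by blast
    then obtain y s where s: "0 \<le> s" "s \<le> T"
      and max: "\<And>x t. 0 \<le> t \<Longrightarrow> t \<le> T \<Longrightarrow> f t x - e * t \<le> f s y - e * s"
      using that[of "snd p" "fst p"] by (auto simp: Q_def)
    have "s = 0"
    proof (rule ccontr)
      assume "s \<noteq> 0"
      hence s0: "s > 0" using s by simp
      obtain D where D: "D \<le> 0" "((\<lambda>s. f s y) has_real_derivative D) (at s)"
        using crit[OF s0, of y] max[of s] s by force
      have "((\<lambda>s. f s y - e * s) has_real_derivative (D - e)) (at s)"
        by (auto intro!: derivative_eq_intros D(2))
      moreover have "D - e < 0" using D e by simp
      ultimately obtain d where d: "d > 0" "\<And>h. 0 < h \<Longrightarrow> h < d \<Longrightarrow> f s y - e * s < f (s - h) y - e * (s - h)"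
        using DERIV_neg_dec_left by blast
      define h where "h = min d s / 2"
      have "0 < h" "h < d" "h < s" using d s0 by (auto simp: h_def)
      with d(2)[of h] max[of "s - h" y] s show False by simp
    qed
    thus ?thesis using max[of T x] init[of y] T by simp
  qed
  show ?thesis
  proof (rule field_le_epsilon)
    fix \<epsilon> :: real assume "\<epsilon> > 0"
    hence "f T x - \<epsilon> / (T + 1) * T \<le> M" using T by (intro bound) simp
    moreover have "\<epsilon> / (T + 1) * T \<le> \<epsilon>" using T \<open>\<epsilon> > 0\<close> by (simp add: field_simps)
    ultimately show "f T x \<le> M + \<epsilon>" by simp
  qed
qed

section \<open>Extrema along the flow\<close>

lemma kaehler_form_positive_11:
  assumes "kaehler_form A \<omega>" "c \<in> A" "z \<in> chart_image c"
  shows "positive_11_form (\<omega> c z)"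
proof -
  have "alt_form 2 (\<omega> c z)"
    using assms unfolding kaehler_form_def smooth_form_def by blast
  then show ?thesis using assms unfolding kaehler_form_def positive_11_form_def by blast
qed

text \<open>The flow equation in a chart around \<open>x\<close>: \<open>u\<close> is \<open>\<Phi> t\<close> in the coordinates, \<open>z\<close> the image
  of \<open>x\<close>, \<open>g\<close> the value of \<open>\<omega>\<close> and \<open>D\<close> the time derivative. Both positive forms are part of the
  conclusion since the top powers are compared only for positive forms.\<close>

lemma flow_local_data:
  fixes A :: "('x::t2_space, 'n::finite) chart set"
  assumes X: "compact_kaehler_manifold A \<omega>" and flow: "ma_flow_solution A \<omega> \<phi> \<Phi>" and t: "0 < t"
  obtains V u z g D where "open V" "z \<in> V" "Ck_on 2 V (u :: complex^'n \<Rightarrow> real)" "u z = \<Phi> t x"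
      "\<And>y. y \<in> V \<Longrightarrow> \<exists>x'. u y = \<Phi> t x'"
    "((\<lambda>s. \<Phi> s x) has_real_derivative D) (at t)"
    "positive_11_form g" "positive_11_form (\<lambda>vs. g vs + ddc (fun_form u) z vs)"
    "\<And>vs. wedge_power (\<lambda>vs. g vs + ddc (fun_form u) z vs) CARD('n) vs
        = complex_of_real (exp D) * wedge_power g CARD('n) vs"
proof -
  have atlas: "holomorphic_atlas A" and \<omega>: "kaehler_form A \<omega>"
    using X by (auto simp: compact_kaehler_manifold_def)
  obtain c where c: "c \<in> A" "x \<in> fst c" using atlas unfolding holomorphic_atlas_def by blast
  define V where "V = chart_image c"
  define z where "z = snd c x"
  define u where "u = \<Phi> t \<circ> chart_inv c"
  define F where "F = (\<lambda>(z, t). \<Phi> t (chart_inv c z))"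
  have V: "open V" and hom: "homeomorphism (fst c) V (snd c) (chart_inv c)"
    using atlas c unfolding holomorphic_atlas_def V_def by blast+
  have z: "z \<in> V" using c by (simp add: V_def z_def chart_image_def)
  have inv: "chart_inv c z = x" using hom c by (simp add: homeomorphism_def z_def)
  have smooth: "smooth_on (V \<times> {0<..}) F"
    using flow c by (simp add: ma_flow_solution_def V_def F_def)
  have "Ck_on 2 V (\<lambda>z. F (z, t))"
    using smooth t by (intro Ck_on_slice[where T = "{0<..}"] V) (auto simp: smooth_on_def)
  hence u: "Ck_on 2 V u" by (simp add: F_def u_def o_def)
  have "F differentiable (at (z, t))"
  proof -
    have "Ck_on (Suc 0) (V \<times> {0<..}) F" using smooth unfolding smooth_on_def by blast
    moreover have "open (V \<times> {0::real<..})" using V by (simp add: open_Times)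
    ultimately show ?thesis using z t by (simp add: differentiable_on_eq_differentiable_at)
  qed
  moreover have "(\<lambda>s. (z, s)) differentiable (at t)"
    by (intro differentiable_Pair) simp_all
  ultimately have "(F \<circ> (\<lambda>s. (z, s))) differentiable (at t)" by (intro differentiable_chain_at)
  hence "(\<lambda>s. \<Phi> s x) differentiable (at t)" by (simp add: F_def o_def inv)
  hence D: "((\<lambda>s. \<Phi> s x) has_real_derivative deriv (\<lambda>s. \<Phi> s x) t) (at t)"
    using DERIV_deriv_iff_real_differentiable by blast
  have plus: "plus_ddc \<omega> (\<Phi> t) c z = (\<lambda>vs. \<omega> c z vs + ddc (fun_form u) z vs)"
    by (simp add: plus_ddc_def u_def)
  have "kaehler_form A (plus_ddc \<omega> (\<Phi> t))" using flow t by (simp add: ma_flow_solution_def)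
  from kaehler_form_positive_11[OF this c(1), of z] z
  have pos: "positive_11_form (\<lambda>vs. \<omega> c z vs + ddc (fun_form u) z vs)"
    by (simp add: plus V_def)
  have "wedge_power (plus_ddc \<omega> (\<Phi> t) c z) CARD('n) vs =
        complex_of_real (exp (deriv (\<lambda>s. \<Phi> s (chart_inv c z)) t)) * wedge_power (\<omega> c z) CARD('n) vs" for vs
    using flow t c(1) z unfolding ma_flow_solution_def V_def by blast
  hence eq: "wedge_power (\<lambda>vs. \<omega> c z vs + ddc (fun_form u) z vs) CARD('n) vs =
        complex_of_real (exp (deriv (\<lambda>s. \<Phi> s x) t)) * wedge_power (\<omega> c z) CARD('n) vs" for vs
    unfolding plus inv .
  show ?thesis
    by (rule that[OF V z u _ _ D kaehler_form_positive_11[OF \<omega> c(1)] pos eq])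
       (use z in \<open>auto simp: u_def inv V_def\<close>)
qed

text \<open>At a maximum \<open>\<omega> + dd\<^sup>c \<Phi> t \<le> \<omega>\<close>, so the monotonicity of the top power applies with
  constant \<open>exp (- D)\<close>.\<close>

lemma flow_velocity_nonpos_at_max:
  fixes A :: "('x::t2_space, 'n::finite) chart set"
  assumes X: "compact_kaehler_manifold A \<omega>" and flow: "ma_flow_solution A \<omega> \<phi> \<Phi>" and t: "0 < t"
    and max: "\<And>y. \<Phi> t y \<le> \<Phi> t x"
  shows "\<exists>D\<le>0. ((\<lambda>s. \<Phi> s x) has_real_derivative D) (at t)"
proof -
  obtain V u z g D where V: "open V" "z \<in> V"
    and u: "Ck_on 2 V (u :: complex^'n \<Rightarrow> real)" "u z = \<Phi> t x"
      "\<And>y. y \<in> V \<Longrightarrow> \<exists>x'. u y = \<Phi> t x'"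
    and D: "((\<lambda>s. \<Phi> s x) has_real_derivative D) (at t)"
    and pos: "positive_11_form g" "positive_11_form (\<lambda>vs. g vs + ddc (fun_form u) z vs)"
    and eq: "\<And>vs. wedge_power (\<lambda>vs. g vs + ddc (fun_form u) z vs) CARD('n) vs
        = complex_of_real (exp D) * wedge_power g CARD('n) vs"
    by (rule flow_local_data[OF X flow t, where x = x]) (rule that)
  have "u y \<le> u z" if "y \<in> V" for y using u(2) u(3)[OF that] max by auto
  hence "second_derivative u z v \<le> 0" for v
    by (rule second_derivative_nonpos_at_local_max[OF u(1) V])
  hence "Re (ddc (fun_form u) z [v, \<i> *s v]) \<le> 0" for v
    unfolding ddc_fun_form[OF u(1) V] by (simp add: divide_nonpos_pos add_nonpos_nonpos)
  moreover have "wedge_power g CARD('n) vs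
      = complex_of_real (exp (- D)) * wedge_power (\<lambda>vs. g vs + ddc (fun_form u) z vs) CARD('n) vs" for vs
    unfolding eq by (simp add: exp_minus)
  ultimately have "1 \<le> exp (- D)" by (intro wedge_power_monotone[OF pos(2,1)]) auto
  with D show ?thesis by auto
qed

text \<open>The inequality of forms is reversed at a minimum, and the monotonicity applies to the flow
  equation itself, with constant \<open>exp D\<close>.\<close>

lemma flow_velocity_nonneg_at_min:
  fixes A :: "('x::t2_space, 'n::finite) chart set"
  assumes X: "compact_kaehler_manifold A \<omega>" and flow: "ma_flow_solution A \<omega> \<phi> \<Phi>" and t: "0 < t"
    and min: "\<And>y. \<Phi> t x \<le> \<Phi> t y"
  shows "\<exists>D\<ge>0. ((\<lambda>s. \<Phi> s x) has_real_derivative D) (at t)"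
proof -
  obtain V u z g D where V: "open V" "z \<in> V"
    and u: "Ck_on 2 V (u :: complex^'n \<Rightarrow> real)" "u z = \<Phi> t x"
      "\<And>y. y \<in> V \<Longrightarrow> \<exists>x'. u y = \<Phi> t x'"
    and D: "((\<lambda>s. \<Phi> s x) has_real_derivative D) (at t)"
    and pos: "positive_11_form g" "positive_11_form (\<lambda>vs. g vs + ddc (fun_form u) z vs)"
    and eq: "\<And>vs. wedge_power (\<lambda>vs. g vs + ddc (fun_form u) z vs) CARD('n) vs
        = complex_of_real (exp D) * wedge_power g CARD('n) vs"
    by (rule flow_local_data[OF X flow t, where x = x]) (rule that)
  have "u z \<le> u y" if "y \<in> V" for y using u(2) u(3)[OF that] min by auto
  hence "0 \<le> second_derivative u z v" for v
    by (rule second_derivative_nonneg_at_local_min[OF u(1) V])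
  hence "0 \<le> Re (ddc (fun_form u) z [v, \<i> *s v])" for v
    unfolding ddc_fun_form[OF u(1) V] by simp
  hence "1 \<le> exp D" by (intro wedge_power_monotone[OF pos _ eq]) auto
  with D show ?thesis by auto
qed

theorem proposition3p1:
  fixes A :: "('x::t2_space, 'n::finite) chart set"
    and \<omega> :: "('x, 'n) manifold_form"
    and \<phi> :: "'x \<Rightarrow> real"
    and \<psi>\<^sub>p \<psi>\<^sub>m :: "'x \<Rightarrow> ereal"
    and \<Phi> :: "real \<Rightarrow> 'x \<Rightarrow> real"
  assumes "compact_kaehler_manifold A \<omega>"
    and "continuous_omega_psh A \<omega> \<phi>"
    and "qpsh A \<psi>\<^sub>p" and "qpsh A \<psi>\<^sub>m"
    and "(\<integral>\<^sup>+x. eexp (- \<psi>\<^sub>m x) \<partial>volume_measure A \<omega>) < \<infinity>"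
    and "monge_ampere_measure A \<omega> \<phi> (density (volume_measure A \<omega>) (\<lambda>x. eexp (\<psi>\<^sub>p x - \<psi>\<^sub>m x)))"
    and "ma_flow_solution A \<omega> \<phi> \<Phi>"
  shows "\<forall>x. \<forall>t\<ge>0. (INF y. \<phi> y) \<le> \<Phi> t x \<and> \<Phi> t x \<le> (SUP y. \<phi> y)"
proof (intro allI impI)
  fix x :: 'x and t :: real assume t: "0 \<le> t"
  note X = assms(1) and flow = assms(7)
  have comp: "compact (UNIV :: 'x set)" using X by (simp add: compact_kaehler_manifold_def)
  have cont: "continuous_on (UNIV \<times> {0..}) (\<lambda>(x, t). \<Phi> t x)" and init: "\<Phi> 0 = \<phi>"
    using flow by (auto simp: ma_flow_solution_def)
  have "continuous_on UNIV \<phi>" using assms(2) by (simp add: continuous_omega_psh_def)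
  hence "bounded (range \<phi>)" by (intro compact_imp_bounded compact_continuous_image comp)
  hence bdd: "bdd_below (range \<phi>)" "bdd_above (range \<phi>)"
    by (auto intro: bounded_imp_bdd_below bounded_imp_bdd_above)
  have "\<Phi> t x \<le> (SUP y. \<phi> y)"
  proof (rule parabolic_maximum_principle[OF comp cont _ _ t])
    show "\<exists>D\<le>0. ((\<lambda>s. \<Phi> s x) has_real_derivative D) (at t)"
      if "0 < t" "\<And>y. \<Phi> t y \<le> \<Phi> t x" for t x
      using flow_velocity_nonpos_at_max[OF X flow that] .
    show "\<Phi> 0 x \<le> (SUP y. \<phi> y)" for x unfolding init using bdd by (intro cSUP_upper) auto
  qed
  moreover have "- \<Phi> t x \<le> - (INF y. \<phi> y)"
  proof (rule parabolic_maximum_principle[OF comp _ _ _ t])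
    show "continuous_on (UNIV \<times> {0..}) (\<lambda>(x, t). - \<Phi> t x)"
      using continuous_on_minus[OF cont] by (simp add: case_prod_beta)
    show "\<exists>D\<le>0. ((\<lambda>s. - \<Phi> s x) has_real_derivative D) (at t)"
      if t: "0 < t" and max: "\<And>y. - \<Phi> t y \<le> - \<Phi> t x" for t x
    proof -
      have "\<Phi> t x \<le> \<Phi> t y" for y using max[of y] by simp
      then obtain D where "D \<ge> 0" "((\<lambda>s. \<Phi> s x) has_real_derivative D) (at t)"
        using flow_velocity_nonneg_at_min[OF X flow t] by blast
      then show ?thesis by (intro exI[of _ "- D"]) (auto intro: DERIV_minus)
    qed
    show "- \<Phi> 0 x \<le> - (INF y. \<phi> y)" for x
      unfolding init neg_le_iff_le using bdd by (intro cINF_lower) auto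
  qed
  ultimately show "(INF y. \<phi> y) \<le> \<Phi> t x \<and> \<Phi> t x \<le> (SUP y. \<phi> y)" by simp
qed

end
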